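(* Let $S\subset\mathbb{R}^n$ be nonempty and closed, let $I=\{1,\ldots,m\}$, $J=\{1,\ldots,p\}$, let $f_i^L,f_i^U,g_i^L,g_i^U\colon\mathbb{R}^n\to\mathbb{R}$ ($i\in I$) and $h_j\colon\mathbb{R}^n\to\mathbb{R}$ ($j\in J$) be locally Lipschitzian functions with $0\le f_i^L(x)\le f_i^U(x)$ and $0<g_i^L(x)\le g_i^U(x)$ for all $x\in S$, $i\in I$, and let $\Omega=\{x\in S: h_j(x)\le 0,\ j\in J\}$. If $\bar x\in\Omega$ is a type-2 weakly Pareto solution of the fractional interval-valued multiobjective problem (FIMP) and the constraint qualification (CQ) holds at $\bar x$, then $\bar x$ satisfies the KKT condition.
   Context: Variational analysis. For $S\subset\mathbb{R}^n$, $x\in S$ and $\varepsilon\ge 0$, $\widehat N_\varepsilon(x;S):=\{z^*\in\mathbb{R}^n:\limsup_{u\to x,\,u\in S}\frac{\langle z^*,u-x\rangle}{\|u-x\|}\le\varepsilon\}$. The limiting (Mordukhovich) normal cone $N(\bar x;S)$ of $S$ at $\bar x\in\mathrm{cl}\,S$ is the set of all $z^*\in\mathbb{R}^n$ for which there exist $x^k\to\bar x$ with $x^k\in S$, $\varepsilon_k\to0^+$ and $z_k^*\to z^*$ with $z_k^*\in\widehat N_{\varepsilon_k}(x^k;S)$ for all $k$. For $\varphi\colon\mathbb{R}^n\to\overline{\mathbb{R}}$ finite at $\bar x$, the limiting (Mordukhovich) subdifferential is $\partial\varphi(\bar x):=\{x^*\in\mathbb{R}^n:(x^*,-1)\in N((\bar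 x,\varphi(\bar x));\mathrm{epi}\,\varphi)\}$, where $\mathrm{epi}\,\varphi=\{(x,\alpha)\in\mathbb{R}^n\times\mathbb{R}:\varphi(x)\le\alpha\}$. The upper subdifferential is $\partial^+\varphi(\bar x):=-\partial(-\varphi)(\bar x)$. Sums and scalar multiples of sets are taken elementwise (Minkowski). Problem. $f_i=[f_i^L,f_i^U]$ and $g_i=[g_i^L,g_i^U]$ are interval-valued functions, and for $i\in I$ and $x\in S$ $$F_i(x):=\frac{f_i(x)}{g_i(x)}=\left[\frac{f_i^L(x)}{g_i^U(x)},\frac{f_i^U(x)}{g_i^L(x)}\right].$$ (FIMP) is the problem of minimizing $F=(F_1,\ldots,F_m)$ over $\Omega$ with respect to the lower-upper (LU) interval order. For closed bounded intervals $A=[a^L,a^U]$, $B=[b^L,b^U]$, write $A<^s_{LU}B$ if $a^L<b^L$ and $a^U<b^U$. A point $\bar x\in\Omega$ is a type-2 weakly Pareto solution of (FIMP) if there is no $x\in\Omega$ such that $F_i(x)<^s_{LU}F_i(\bar x)$ for all $i\in I$. (CQ) holds at $\bar x\in\Omega$ if there do not exist $\mu_j\ge0$, $j\in J(\bar x):=\{j\in J:h_j(\bar x)=0\}$, not all zero, such that $0\in\sum_{j\in J(\bar x)}\mu_j\partial h_j(\bar x)+N(\bar x;S)$. KKT condition: $\bar x\in\Omega$ satisfies the KKT condition if there exist $\lambda_i^L\ge0$, $\lambda_i^U\ge0$, $i\in I$, and $\mu_j\ge0$, $j\in J$, with $\sum_{i\in I}(\lambda_i^L+\lambda_i^U)+\sum_{j\in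 J}\mu_j=1$ and $(\lambda^L,\lambda^U)\ne(0,0)$, where $\lambda^L=(\lambda^L_1,\ldots,\lambda^L_m)$, $\lambda^U=(\lambda^U_1,\ldots,\lambda^U_m)$, such that $$0\in \sum_{i\in I}\frac{\lambda_i^L}{g_i^U(\bar x)} \left[\partial f_i^L(\bar x)-\frac{f_i^L(\bar x)}{g_i^U(\bar x)}\partial^+ g_i^U(\bar x)\right]+\sum_{i\in I}\frac{\lambda_i^U}{g_i^L(\bar x)} \left[\partial f_i^U(\bar x)-\frac{f_i^U(\bar x)}{g_i^L(\bar x)}\partial^+ g_i^L(\bar x)\right]+\sum_{j\in J}\mu_j\partial h_j(\bar x)+N(\bar x; S)$$ and $\mu_jh_j(\bar x)=0$ for all $j\in J$. *)

theory Defs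
  imports
    "HOL-Analysis.Analysis"
    "HOL-Library.Set_Algebras"
    "HOL-Library.Interval"
begin

section \<open>Normal cones and subdifferentials\<close>

text \<open>
  The filter \<^term>\<open>at x within S\<close> excludes \<open>u = x\<close>. If \<open>x\<close> is isolated in \<open>S\<close>, the upper
  limit is \<open>-\<infinity>\<close> and every vector is a normal. The set is meant for \<open>x \<in> S\<close> and \<open>\<epsilon> \<ge> 0\<close>;
  both conditions are imposed where it is used.
\<close>

definition eps_normals :: "real \<Rightarrow> 'a::euclidean_space \<Rightarrow> 'a set \<Rightarrow> 'a set" where
  "eps_normals \<epsilon> x S =
    {z. Limsup (at x within S) (\<lambda>u. ereal (inner z (u - x) / norm (u - x))) \<le> ereal \<epsilon>}"

definition normal_cone :: "'a::euclidean_space \<Rightarrow> 'a set \<Rightarrow> 'a set" where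
  "normal_cone x S =
    {z. \<exists>(X :: nat \<Rightarrow> 'a) (\<epsilon> :: nat \<Rightarrow> real) (Z :: nat \<Rightarrow> 'a).
          X \<longlonglongrightarrow> x \<and> (\<forall>k. X k \<in> S) \<and>
          \<epsilon> \<longlonglongrightarrow> 0 \<and> (\<forall>k. 0 < \<epsilon> k) \<and>
          Z \<longlonglongrightarrow> z \<and> (\<forall>k. Z k \<in> eps_normals (\<epsilon> k) (X k) S)}"

text \<open>The library's \<^const>\<open>epigraph\<close> is restricted to real-valued functions.\<close>

definition epi :: "('a \<Rightarrow> ereal) \<Rightarrow> ('a \<times> real) set" where
  "epi \<phi> = {(x, \<alpha>). \<phi> x \<le> ereal \<alpha>}"

text \<open>By convention, the subdifferential is empty where \<open>\<phi>\<close> is not finite.\<close>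

definition subdiff :: "('a::euclidean_space \<Rightarrow> ereal) \<Rightarrow> 'a \<Rightarrow> 'a set" where
  "subdiff \<phi> x =
    {v. \<bar>\<phi> x\<bar> \<noteq> \<infinity> \<and> (v, -1) \<in> normal_cone (x, real_of_ereal (\<phi> x)) (epi \<phi>)}"

definition upper_subdiff :: "('a::euclidean_space \<Rightarrow> ereal) \<Rightarrow> 'a \<Rightarrow> 'a set" where
  "upper_subdiff \<phi> x = uminus ` subdiff (\<lambda>y. - \<phi> y) x"

definition locally_lipschitzian :: "('a::metric_space \<Rightarrow> 'b::metric_space) \<Rightarrow> bool" where
  "locally_lipschitzian f \<longleftrightarrow> (\<forall>x. \<exists>e>0. \<exists>L. L-lipschitz_on (ball x e) f)"


section \<open>The fractional interval-valued problem\<close>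

definition less_LU_strict :: "real interval \<Rightarrow> real interval \<Rightarrow> bool" where
  "less_LU_strict A B \<longleftrightarrow> lower A < lower B \<and> upper A < upper B"

text \<open>
  \<^term>\<open>Ivl a b\<close> is the interval with end points \<open>a\<close> and \<open>b\<close> whenever \<open>a \<le> b\<close>; the sign
  conditions on \<open>f\<close> and \<open>g\<close> guarantee this for the quotient at every point of \<open>S\<close>.
\<close>

definition frac_ivl ::
  "(nat \<Rightarrow> 'a \<Rightarrow> real) \<Rightarrow> (nat \<Rightarrow> 'a \<Rightarrow> real) \<Rightarrow> (nat \<Rightarrow> 'a \<Rightarrow> real) \<Rightarrow> (nat \<Rightarrow> 'a \<Rightarrow> real) \<Rightarrow>
    nat \<Rightarrow> 'a \<Rightarrow> real interval" where
  "frac_ivl fL fU gL gU i x = Ivl (fL i x / gU i x) (fU i x / gL i x)"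

definition feasible_set :: "'a set \<Rightarrow> nat \<Rightarrow> (nat \<Rightarrow> 'a \<Rightarrow> real) \<Rightarrow> 'a set" where
  "feasible_set S p h = {x \<in> S. \<forall>j\<in>{1..p}. h j x \<le> 0}"

definition type2_weakly_pareto ::
  "nat \<Rightarrow> (nat \<Rightarrow> 'a \<Rightarrow> real interval) \<Rightarrow> 'a set \<Rightarrow> 'a \<Rightarrow> bool" where
  "type2_weakly_pareto m F \<Omega> xb \<longleftrightarrow>
    xb \<in> \<Omega> \<and> \<not> (\<exists>x\<in>\<Omega>. \<forall>i\<in>{1..m}. less_LU_strict (F i x) (F i xb))"

definition active_set :: "nat \<Rightarrow> (nat \<Rightarrow> 'a \<Rightarrow> real) \<Rightarrow> 'a \<Rightarrow> nat set" where
  "active_set p h xb = {j \<in> {1..p}. h j xb = 0}"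

text \<open>
  Addition and \<open>\<Sum>\<close> of sets are elementwise (Minkowski), the empty sum being \<open>{0}\<close>. Binary
  minus on sets is the set-theoretic difference, so elementwise differences are written as
  sums with a negative multiple.
\<close>

definition CQ ::
  "'a::euclidean_space set \<Rightarrow> nat \<Rightarrow> (nat \<Rightarrow> 'a \<Rightarrow> real) \<Rightarrow> 'a \<Rightarrow> bool" where
  "CQ S p h xb \<longleftrightarrow>
    \<not> (\<exists>\<mu> :: nat \<Rightarrow> real.
        (\<forall>j\<in>active_set p h xb. 0 \<le> \<mu> j) \<and>
        (\<exists>j\<in>active_set p h xb. \<mu> j \<noteq> 0) \<and>
        0 \<in> (\<Sum>j\<in>active_set p h xb. (*\<^sub>R) (\<mu> j) ` subdiff (\<lambda>y. ereal (h j y)) xb)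
            + normal_cone xb S)"

definition frac_term ::
  "('a::euclidean_space \<Rightarrow> real) \<Rightarrow> ('a \<Rightarrow> real) \<Rightarrow> 'a \<Rightarrow> 'a set" where
  "frac_term \<phi> \<psi> x =
    subdiff (\<lambda>y. ereal (\<phi> y)) x
      + (*\<^sub>R) (- (\<phi> x / \<psi> x)) ` upper_subdiff (\<lambda>y. ereal (\<psi> y)) x"

definition KKT ::
  "'a::euclidean_space set \<Rightarrow> nat \<Rightarrow> nat \<Rightarrow>
    (nat \<Rightarrow> 'a \<Rightarrow> real) \<Rightarrow> (nat \<Rightarrow> 'a \<Rightarrow> real) \<Rightarrow> (nat \<Rightarrow> 'a \<Rightarrow> real) \<Rightarrow> (nat \<Rightarrow> 'a \<Rightarrow> real) \<Rightarrow>
    (nat \<Rightarrow> 'a \<Rightarrow> real) \<Rightarrow> 'a \<Rightarrow> bool" where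
  "KKT S m p fL fU gL gU h xb \<longleftrightarrow>
    xb \<in> feasible_set S p h \<and>
    (\<exists>(lamL :: nat \<Rightarrow> real) (lamU :: nat \<Rightarrow> real) (\<mu> :: nat \<Rightarrow> real).
      (\<forall>i\<in>{1..m}. 0 \<le> lamL i \<and> 0 \<le> lamU i) \<and>
      (\<forall>j\<in>{1..p}. 0 \<le> \<mu> j) \<and>
      (\<Sum>i\<in>{1..m}. lamL i + lamU i) + (\<Sum>j\<in>{1..p}. \<mu> j) = 1 \<and>
      (\<exists>i\<in>{1..m}. lamL i \<noteq> 0 \<or> lamU i \<noteq> 0) \<and>
      0 \<in> (\<Sum>i\<in>{1..m}. (*\<^sub>R) (lamL i / gU i xb) ` frac_term (fL i) (gU i) xb)
          + (\<Sum>i\<in>{1..m}. (*\<^sub>R) (lamU i / gL i xb) ` frac_term (fU i) (gL i) xb)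
          + (\<Sum>j\<in>{1..p}. (*\<^sub>R) (\<mu> j) ` subdiff (\<lambda>y. ereal (h j y)) xb)
          + normal_cone xb S \<and>
      (\<forall>j\<in>{1..p}. \<mu> j * h j xb = 0))"

end

theory Submission
  imports Defs "HOL-Real_Asymp.Real_Asymp"
begin

text \<open>
  Since the denominators are positive on \<open>S\<close>, the inequality \<open>f x / g x < q\<close> with
  \<open>q = f xb / g xb\<close> is equivalent to \<open>f x - q * g x < 0\<close>. So \<open>xb\<close> minimizes over \<open>S\<close> the maximum of
  the functions \<open>(f - q * g) / g xb\<close> and \<open>h\<close>, and no quotient rule is needed: \<open>- g\<close> enters
  with the nonnegative weight \<open>q / g xb\<close>, which is how the upper subdifferential of \<open>g\<close> arises.

  The multiplier rule for a maximum of nonnegative combinations of Lipschitz functions \<open>w l\<close> is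
  obtained by decoupling. Every \<open>w l\<close> gets its own variable \<open>y l\<close>, the maximum is smoothed by
  log-sum-exp with parameter \<open>\<nu>\<close>, and \<open>\<nu> * (norm (x - y l))\<^sup>2\<close> and \<open>(norm (x - xb))\<^sup>2\<close> are added.
  At a minimizer, optimality in \<open>y l\<close> makes a multiple of \<open>x - y l\<close> a Frechet subgradient of
  \<open>w l\<close>, and optimality in \<open>x\<close> makes the negative weighted sum of these subgradients nearly a
  Frechet normal of \<open>S\<close>. The weights are the softmax values, which vanish in the limit
  \<open>\<nu> \<rightarrow> \<infinity>\<close> at inactive components. Lipschitz bounds keep the subgradients bounded, so a
  subsequence converges.
\<close>

section \<open>Frechet normals and subgradients at minimizers\<close>

lemma eps_normalsI:
  assumes "\<forall>\<^sub>F u in at x within S. z \<bullet> (u - x) \<le> \<epsilon> * norm (u - x)"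
  shows "z \<in> eps_normals \<epsilon> x S"
proof -
  have "\<forall>\<^sub>F u in at x within S. ereal (z \<bullet> (u - x) / norm (u - x)) \<le> ereal \<epsilon>"
    using assms unfolding eventually_at_filter
    by eventually_elim (simp add: divide_simps)
  then show ?thesis
    unfolding eps_normals_def by (simp add: Limsup_bounded)
qed

lemma normal_coneI:
  assumes "X \<longlonglongrightarrow> x" "\<And>k. X k \<in> S" "\<epsilon> \<longlonglongrightarrow> 0" "\<And>k. 0 < \<epsilon> k" "Z \<longlonglongrightarrow> z"
    and "\<And>k. Z k \<in> eps_normals (\<epsilon> k) (X k) S"
  shows "z \<in> normal_cone x S"
  unfolding normal_cone_def using assms by blast

text \<open>A point \<open>(u, a)\<close> of the epigraph has \<open>a \<ge> w u\<close>, so pairing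
  \<open>(v, -1)\<close> with its offset gives at most
  \<open>v \<bullet> (u - y) - (w u - w y)\<close>, and the norm of the offset dominates
  \<open>norm (u - y)\<close>.\<close>

lemma subgradient_imp_epi_normal:
  fixes w :: "'a::euclidean_space \<Rightarrow> real"
  assumes "0 \<le> \<epsilon>"
    and "\<forall>\<^sub>F u in nhds y. v \<bullet> (u - y) - \<epsilon> * norm (u - y) \<le> w u - w y"
  shows "(v, -1) \<in> eps_normals \<epsilon> (y, w y) (epi (\<lambda>x. ereal (w x)))"
proof (rule eps_normalsI)
  obtain d where "d > 0"
    and d: "\<And>u. dist u y < d \<Longrightarrow> v \<bullet> (u - y) - \<epsilon> * norm (u - y) \<le> w u - w y"
    using assms(2) unfolding eventually_nhds_metric by blast
  have "(v, -1) \<bullet> (z - (y, w y)) \<le> \<epsilon> * norm (z - (y, w y))"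
    if z: "z \<in> epi (\<lambda>x. ereal (w x))" "dist z (y, w y) < d" for z
  proof -
    obtain u a where ua: "z = (u, a)" by fastforce
    have "w u \<le> a" using z ua by (simp add: epi_def)
    have "dist u y \<le> dist z (y, w y)"
      using dist_fst_le[of z "(y, w y)"] ua by simp
    then have "v \<bullet> (u - y) - \<epsilon> * norm (u - y) \<le> w u - w y"
      using d z(2) by simp
    moreover have "norm (u - y) \<le> norm (z - (y, w y))"
      using norm_fst_le[of "u - y" "a - w y"] ua by simp
    then have "\<epsilon> * norm (u - y) \<le> \<epsilon> * norm (z - (y, w y))"
      using assms(1) by (rule mult_left_mono)
    ultimately show ?thesis using ua \<open>w u \<le> a\<close> by (simp add: inner_Pair)
  qed
  then show "\<forall>\<^sub>F z in at (y, w y) within epi (\<lambda>x. ereal (w x)).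
      (v, -1) \<bullet> (z - (y, w y)) \<le> \<epsilon> * norm (z - (y, w y))"
    unfolding eventually_at using \<open>d > 0\<close> by blast
qed

lemma norm_diff_sq_expand:
  fixes a x u :: "'a::real_inner"
  shows "(norm (u - a))\<^sup>2 - (norm (x - a))\<^sup>2 = 2 * ((x - a) \<bullet> (u - x)) + (norm (u - x))\<^sup>2"
  by (simp add: power2_norm_eq_inner algebra_simps inner_commute)

lemma eventually_quadratic_le:
  fixes y :: "'a::real_normed_vector"
  assumes "0 < \<epsilon>"
  shows "\<forall>\<^sub>F u in nhds y. c * (norm (u - y))\<^sup>2 \<le> \<epsilon> * norm (u - y)"
proof -
  have "\<forall>\<^sub>F u in nhds y. c * norm (u - y) < \<epsilon>"
  proof (rule order_tendstoD)
    show "((\<lambda>u. c * norm (u - y)) \<longlongrightarrow> c * norm (y - y)) (nhds y)"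
      by (intro tendsto_intros filterlim_ident)
  qed (use assms in simp)
  then show ?thesis
    by eventually_elim (metis less_eq_real_def mult.assoc mult_right_mono norm_ge_zero power2_eq_square)
qed

text \<open>First-order optimality over \<open>S\<close>: \<open>?z\<close> is the negative gradient
  of the objective at \<open>x\<close>. The objective is quadratic, so its expansion at
  \<open>x\<close> is exact with second-order term \<open>c * (norm (u - x))\<^sup>2\<close>, which
  falls below \<open>\<epsilon> * norm (u - x)\<close> near \<open>x\<close>.\<close>

lemma local_minimizer_normal:
  fixes y :: "'l \<Rightarrow> 'a::euclidean_space"
  assumes min: "\<forall>\<^sub>F u in at x within S.
      (\<Sum>l\<in>L. \<nu> * (norm (x - y l))\<^sup>2) + (norm (x - a))\<^sup>2
        \<le> (\<Sum>l\<in>L. \<nu> * (norm (u - y l))\<^sup>2) + (norm (u - a))\<^sup>2"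
    and "0 < \<epsilon>"
  shows "- (\<Sum>l\<in>L. (2 * \<nu>) *\<^sub>R (x - y l)) - 2 *\<^sub>R (x - a) \<in> eps_normals \<epsilon> x S" (is "?z \<in> _")
proof (rule eps_normalsI)
  define c where "c = (\<Sum>l\<in>L. \<nu>) + 1"
  have eq: "(\<Sum>l\<in>L. \<nu> * (norm (u - y l))\<^sup>2) + (norm (u - a))\<^sup>2
      - ((\<Sum>l\<in>L. \<nu> * (norm (x - y l))\<^sup>2) + (norm (x - a))\<^sup>2)
      = c * (norm (u - x))\<^sup>2 - ?z \<bullet> (u - x)" (is "?l = ?r") for u
  proof -
    have "?l = (\<Sum>l\<in>L. \<nu> * ((norm (u - y l))\<^sup>2 - (norm (x - y l))\<^sup>2))
        + ((norm (u - a))\<^sup>2 - (norm (x - a))\<^sup>2)"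
      by (simp add: sum_subtractf right_diff_distrib)
    also have "\<dots> = (\<Sum>l\<in>L. (2 * \<nu>) * ((x - y l) \<bullet> (u - x)) + \<nu> * (norm (u - x))\<^sup>2)
        + (2 * ((x - a) \<bullet> (u - x)) + (norm (u - x))\<^sup>2)"
      unfolding norm_diff_sq_expand by (simp add: algebra_simps)
    also have "\<dots> = ?r"
      by (simp add: c_def sum.distrib inner_diff_left inner_sum_left sum_distrib_right
          distrib_right del: sum_constant)
    finally show ?thesis .
  qed
  have "\<forall>\<^sub>F u in at x within S. c * (norm (u - x))\<^sup>2 \<le> \<epsilon> * norm (u - x)"
    using eventually_quadratic_le[OF assms(2), of c x] unfolding eventually_at_filter
    by eventually_elim simp
  with min show "\<forall>\<^sub>F u in at x within S. ?z \<bullet> (u - x) \<le> \<epsilon> * norm (u - x)"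
    by eventually_elim (use eq in \<open>smt (verit)\<close>)
qed

text \<open>Testing along the ray \<open>u = y + t *\<^sub>R v\<close> with \<open>t\<close>
  decreasing to 0 turns the hypothesis into
  \<open>t * (norm v)\<^sup>2 \<le> C * t * norm v\<close>.\<close>

lemma norm_le_of_eventually_inner_le:
  fixes v y :: "'a::real_inner"
  assumes "\<forall>\<^sub>F u in nhds y. v \<bullet> (u - y) \<le> C * norm (u - y)"
  shows "norm v \<le> max C 0"
proof (cases "v = 0")
  case False
  have "((\<lambda>t. y + t *\<^sub>R v) \<longlongrightarrow> y + 0 *\<^sub>R v) (at_right 0)"
    by (intro tendsto_intros)
  then have "filterlim (\<lambda>t. y + t *\<^sub>R v) (nhds y) (at_right 0)" by simp
  from eventually_compose_filterlim[OF assms this]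
  have "\<forall>\<^sub>F t in at_right 0. v \<bullet> (t *\<^sub>R v) \<le> C * norm (t *\<^sub>R v)" by simp
  moreover have "\<forall>\<^sub>F t in at_right 0. (0::real) < t"
    by (simp add: eventually_at_right_less)
  ultimately have "\<forall>\<^sub>F t::real in at_right 0. norm v \<le> C"
  proof eventually_elim
    case (elim t)
    then have "t * norm v * norm v \<le> t * norm v * C"
      by (simp add: power2_norm_eq_inner[symmetric] power2_eq_square mult_ac)
    then show ?case using False elim by simp
  qed
  then have "norm v \<le> C" by simp
  then show ?thesis by linarith
qed simp

text \<open>Linearizing \<open>G\<close> at \<open>w y\<close> in the minimality condition leaves
  \<open>\<theta> * (w u - w y)\<close> above the linear part of the penalty, up to an error;
  dividing by \<open>\<theta> > 0\<close> gives the subgradient inequality. The Lipschitz bound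
  makes an error small relative to \<open>w u - w y\<close> also small relative to
  \<open>u - y\<close>.\<close>

lemma subgradient_of_penalized_minimizer:
  fixes w :: "'a::euclidean_space \<Rightarrow> real" and G :: "real \<Rightarrow> real"
  assumes lip: "\<forall>\<^sub>F u in nhds y. \<bar>w u - w y\<bar> \<le> C * norm (u - y)"
    and deriv: "(G has_real_derivative \<theta>) (at (w y))" and "0 < \<theta>"
    and min: "\<forall>\<^sub>F u in nhds y. G (w y) + \<nu> * (norm (x - y))\<^sup>2 \<le> G (w u) + \<nu> * (norm (x - u))\<^sup>2"
    and "0 < \<epsilon>"
  shows "\<forall>\<^sub>F u in nhds y. ((2 * \<nu> / \<theta>) *\<^sub>R (x - y)) \<bullet> (u - y) - \<epsilon> * norm (u - y) \<le> w u - w y"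
proof -
  \<comment> \<open>Chosen so that the linearization error is at most
    \<open>(\<epsilon> * \<theta> / 2) * n\<close>. The quadratic term of the penalty takes the
    other half, and division by \<open>\<theta>\<close> leaves \<open>\<epsilon>\<close>.\<close>
  define e where "e = \<epsilon> * \<theta> / (2 * (\<bar>C\<bar> + 1))"
  have "e > 0" using assms by (simp add: e_def)
  then obtain d where "d > 0"
    and d: "\<And>s. \<bar>s - w y\<bar> < d \<Longrightarrow> \<bar>G s - G (w y) - \<theta> * (s - w y)\<bar> \<le> e * \<bar>s - w y\<bar>"
    using deriv unfolding has_field_derivative_def has_derivative_at_alt by fastforce
  have "\<forall>\<^sub>F u in nhds y. C * norm (u - y) < d"
  proof (rule order_tendstoD)
    show "((\<lambda>u. C * norm (u - y)) \<longlongrightarrow> C * norm (y - y)) (nhds y)"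
      by (intro tendsto_intros filterlim_ident)
  qed (use \<open>d > 0\<close> in simp)
  moreover have "\<forall>\<^sub>F u in nhds y. \<nu> * (norm (u - y))\<^sup>2 \<le> (\<epsilon> * \<theta> / 2) * norm (u - y)"
    using assms by (intro eventually_quadratic_le) simp
  ultimately show ?thesis using lip min
  proof eventually_elim
    case (elim u)
    define n where "n = norm (u - y)"
    have "\<bar>G (w u) - G (w y) - \<theta> * (w u - w y)\<bar> \<le> e * \<bar>w u - w y\<bar>"
      using d[of "w u"] elim by linarith
    also have "\<dots> \<le> e * ((\<bar>C\<bar> + 1) * n)"
    proof (intro mult_left_mono)
      have "C * n \<le> (\<bar>C\<bar> + 1) * n" unfolding n_def by (intro mult_right_mono) auto
      then show "\<bar>w u - w y\<bar> \<le> (\<bar>C\<bar> + 1) * n" using elim n_def by simp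
    qed (use \<open>e > 0\<close> in simp)
    also have "\<dots> = (\<epsilon> * \<theta> / 2) * n"
    proof -
      have "e * (\<bar>C\<bar> + 1) = \<epsilon> * \<theta> / 2" unfolding e_def by (simp add: field_simps)
      then show ?thesis by (metis mult.assoc)
    qed
    finally have 1: "G (w u) - G (w y) \<le> \<theta> * (w u - w y) + (\<epsilon> * \<theta> / 2) * n" by linarith
    have "(norm (x - u))\<^sup>2 - (norm (x - y))\<^sup>2 = n\<^sup>2 - 2 * ((x - y) \<bullet> (u - y))"
      using norm_diff_sq_expand[of u x y] unfolding n_def
      by (simp add: norm_minus_commute inner_diff_left)
    then have "\<nu> * (norm (x - u))\<^sup>2 - \<nu> * (norm (x - y))\<^sup>2 = \<nu> * n\<^sup>2 - 2 * \<nu> * ((x - y) \<bullet> (u - y))"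
      by (metis mult.assoc mult.left_commute right_diff_distrib)
    with 1 elim have "2 * \<nu> * ((x - y) \<bullet> (u - y)) - \<theta> * \<epsilon> * n \<le> \<theta> * (w u - w y)"
      unfolding n_def by (simp add: algebra_simps)
    then have "(2 * \<nu> * ((x - y) \<bullet> (u - y)) - \<theta> * \<epsilon> * n) / \<theta> \<le> w u - w y"
      using \<open>0 < \<theta>\<close> by (simp add: pos_divide_le_eq mult.commute)
    then show ?case using \<open>0 < \<theta>\<close> by (simp add: diff_divide_distrib n_def)
  qed
qed

section \<open>Local Lipschitz continuity on a common ball\<close>

lemma locally_lipschitzian_uminus:
  fixes f :: "'a::metric_space \<Rightarrow> 'b::real_normed_vector"
  assumes "locally_lipschitzian f"
  shows "locally_lipschitzian (\<lambda>x. - f x)"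
  using assms unfolding locally_lipschitzian_def by (simp add: lipschitz_on_minus_iff)

text \<open>Supplies the radius and the constant for \<open>max_multiplier\<close>. The ball is
  closed because closed balls of a Euclidean space are compact, which later yields
  minimizers.\<close>

lemma locally_lipschitzian_uniform:
  fixes w :: "'l \<Rightarrow> 'a::metric_space \<Rightarrow> 'b::metric_space"
  assumes "finite L" and "\<And>l. l \<in> L \<Longrightarrow> locally_lipschitzian (w l)"
  shows "\<exists>r>0. \<exists>C. \<forall>l\<in>L. C-lipschitz_on (cball a r) (w l)"
  using assms
proof (induction rule: finite_induct)
  case empty
  show ?case by (auto intro: exI[of _ 1])
next
  case (insert l L)
  then obtain r C where "r > 0" and C: "\<forall>l\<in>L. C-lipschitz_on (cball a r) (w l)"
    by auto
  obtain e C' where "e > 0" and C': "C'-lipschitz_on (ball a e) (w l)"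
    using insert.prems[of l] unfolding locally_lipschitzian_def by blast
  define r' where "r' = min r (e / 2)"
  have "cball a r' \<subseteq> cball a r" "cball a r' \<subseteq> ball a e"
    using \<open>e > 0\<close> by (auto simp: r'_def)
  then have "\<forall>l'\<in>insert l L. (max C C')-lipschitz_on (cball a r') (w l')"
    using C C' by (metis insert_iff lipschitz_on_le lipschitz_on_subset max.cobounded1 max.cobounded2)
  moreover have "r' > 0" using \<open>r > 0\<close> \<open>e > 0\<close> by (simp add: r'_def)
  ultimately show ?case by blast
qed

section \<open>Log-sum-exp smoothing of a maximum\<close>

definition lse :: "real \<Rightarrow> 'k set \<Rightarrow> ('k \<Rightarrow> real) \<Rightarrow> real" where
  "lse \<nu> K t = ln (\<Sum>k\<in>K. exp (\<nu> * t k)) / \<nu>"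

definition softmax :: "real \<Rightarrow> 'k set \<Rightarrow> ('k \<Rightarrow> real) \<Rightarrow> 'k \<Rightarrow> real" where
  "softmax \<nu> K t k = exp (\<nu> * t k) / (\<Sum>k\<in>K. exp (\<nu> * t k))"

lemma lse_ge:
  assumes "finite K" "k \<in> K" "\<nu> > 0"
  shows "t k \<le> lse \<nu> K t"
proof -
  have "exp (\<nu> * t k) \<le> (\<Sum>k\<in>K. exp (\<nu> * t k))"
    using assms by (intro member_le_sum) auto
  then have "\<nu> * t k \<le> ln (\<Sum>k\<in>K. exp (\<nu> * t k))"
    by (metis exp_gt_zero less_le_trans ln_exp ln_le_cancel_iff)
  then show ?thesis using assms by (simp add: lse_def field_simps)
qed

text \<open>Each of the \<open>card K\<close> exponentials is at most 1. Together with
  \<open>lse_ge\<close> this controls the error of replacing the maximum by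
  \<open>lse\<close>.\<close>

lemma lse_le_of_nonpos:
  assumes "finite K" "K \<noteq> {}" "\<nu> > 0" "\<And>k. k \<in> K \<Longrightarrow> t k \<le> 0"
  shows "lse \<nu> K t \<le> ln (card K) / \<nu>"
proof -
  have "(\<Sum>k\<in>K. exp (\<nu> * t k)) \<le> (\<Sum>k\<in>K. 1)"
    using assms by (intro sum_mono) (simp add: mult_nonneg_nonpos)
  moreover have "0 < (\<Sum>k\<in>K. exp (\<nu> * t k))"
    using assms by (intro sum_pos) auto
  ultimately have "ln (\<Sum>k\<in>K. exp (\<nu> * t k)) \<le> ln (card K)"
    by (intro ln_mono) auto
  then show ?thesis using assms by (simp add: lse_def divide_right_mono)
qed

lemma continuous_on_lse [continuous_intros]:
  assumes "finite K" "K \<noteq> {}" "\<And>k. k \<in> K \<Longrightarrow> continuous_on X (\<lambda>z. t z k)"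
  shows "continuous_on X (\<lambda>z. lse \<nu> K (t z))"
proof -
  have "(\<Sum>k\<in>K. exp (\<nu> * t z k)) \<noteq> 0" for z
    using assms sum_pos[of K "\<lambda>k. exp (\<nu> * t z k)"] by simp
  then show ?thesis
    unfolding lse_def divide_inverse using assms by (intro continuous_intros) auto
qed

text \<open>Chain rule: the gradient of log-sum-exp is the softmax vector. This is the origin of the
  multipliers.\<close>

lemma has_real_derivative_lse:
  assumes "finite K" "K \<noteq> {}" "\<nu> > 0"
    and "\<And>k. k \<in> K \<Longrightarrow> ((\<lambda>s. t s k) has_real_derivative a k) (at s0)"
  shows "((\<lambda>s. lse \<nu> K (t s)) has_real_derivative (\<Sum>k\<in>K. softmax \<nu> K (t s0) k * a k)) (at s0)"
proof -
  have "0 < (\<Sum>k\<in>K. exp (\<nu> * t s0 k))"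
    using assms by (intro sum_pos) auto
  then show ?thesis
    unfolding lse_def softmax_def using assms(3,4)
    by (auto intro!: derivative_eq_intros sum.cong
        simp: sum_divide_distrib sum_distrib_left[symmetric] sum_distrib_right[symmetric])
qed

lemma softmax_nonneg: "0 \<le> softmax \<nu> K t k"
  by (simp add: softmax_def sum_nonneg)

lemma sum_softmax:
  assumes "finite K" "K \<noteq> {}"
  shows "(\<Sum>k\<in>K. softmax \<nu> K t k) = 1"
proof -
  have "0 < (\<Sum>k\<in>K. exp (\<nu> * t k))"
    using assms by (intro sum_pos) auto
  then show ?thesis by (simp add: softmax_def sum_divide_distrib[symmetric])
qed

text \<open>The normalizing sum is at least its single term at \<open>k'\<close>. A component lying
  below another one by a fixed gap thus has exponentially small weight.\<close>

lemma softmax_le: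
  assumes "finite K" "k' \<in> K"
  shows "softmax \<nu> K t k \<le> exp (\<nu> * t k - \<nu> * t k')"
proof -
  have "exp (\<nu> * t k') \<le> (\<Sum>k\<in>K. exp (\<nu> * t k))"
    using assms by (intro member_le_sum) auto
  then show ?thesis
    unfolding softmax_def exp_diff
    by (intro divide_left_mono mult_pos_pos less_le_trans[OF exp_gt_zero]) auto
qed

section \<open>Varying one coordinate, compact products and common subsequences\<close>

lemma sum_fun_upd:
  fixes f :: "'l \<Rightarrow> 'a \<Rightarrow> 'b::ab_group_add"
  assumes "finite L" "l \<in> L"
  shows "(\<Sum>l'\<in>L. f l' ((y(l := u)) l')) = (\<Sum>l'\<in>L. f l' (y l')) + (f l u - f l (y l))"
proof -
  have "(\<Sum>l'\<in>L - {l}. f l' ((y(l := u)) l')) = (\<Sum>l'\<in>L - {l}. f l' (y l'))"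
    by (rule sum.cong) auto
  then show ?thesis using assms by (simp add: sum.remove)
qed

text \<open>Tychonoff's theorem for the product topology on a function type.\<close>

lemma compact_PiE_UNIV:
  assumes "\<And>l. compact (B l)"
  shows "compact (PiE UNIV B)"
  using assms compactin_PiE[of "\<lambda>_. euclidean" UNIV B] by (simp add: euclidean_product_topology)

lemma compact_seqs_common_subseq:
  fixes f :: "'i \<Rightarrow> nat \<Rightarrow> 'a::metric_space"
  assumes "finite I" "compact B" "\<And>i n. i \<in> I \<Longrightarrow> f i n \<in> B"
  shows "\<exists>r g. strict_mono (r :: nat \<Rightarrow> nat) \<and> (\<forall>i\<in>I. (\<lambda>n. f i (r n)) \<longlonglongrightarrow> g i)"
  using assms(1,3)
proof (induction rule: finite_induct)
  case empty
  show ?case by (auto intro: exI[of _ id] simp: strict_mono_id)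
next
  case (insert i I)
  then obtain r g where r: "strict_mono (r :: nat \<Rightarrow> nat)"
    and g: "\<And>j. j \<in> I \<Longrightarrow> (\<lambda>n. f j (r n)) \<longlonglongrightarrow> g j"
    by (metis insertI2)
  have "\<forall>n. f i (r n) \<in> B" using insert.prems by simp
  then obtain b s where s: "strict_mono (s :: nat \<Rightarrow> nat)" and b: "((\<lambda>n. f i (r n)) \<circ> s) \<longlonglongrightarrow> b"
    using \<open>compact B\<close> unfolding compact_eq_seq_compact_metric seq_compact_def by metis
  have "(\<lambda>n. f j ((r \<circ> s) n)) \<longlonglongrightarrow> (g(i := b)) j" if "j \<in> insert i I" for j
    using that b LIMSEQ_subseq_LIMSEQ[OF g s] insert.hyps by (auto simp: o_def)
  moreover have "strict_mono (r \<circ> s)" using r s by (rule strict_mono_o)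
  ultimately show ?case by blast
qed

section \<open>Multiplier rule for a maximum\<close>

text \<open>The rows \<open>k\<close> of \<open>A\<close> are the functions under the maximum, the
  columns \<open>l\<close> their nonsmooth ingredients \<open>w l\<close>. The last two assumptions
  say that \<open>a\<close> minimizes this maximum over \<open>S\<close>, with minimal value
  0.\<close>

locale max_multiplier =
  fixes K :: "'k set" and L :: "'l set" and A :: "'k \<Rightarrow> 'l \<Rightarrow> real"
    and w :: "'l \<Rightarrow> 'a::euclidean_space \<Rightarrow> real" and S :: "'a set" and a :: 'a and r C :: real
  assumes finite_K: "finite K" and K_nonempty: "K \<noteq> {}" and finite_L: "finite L"
    and A_nonneg: "\<And>k l. 0 \<le> A k l"
    and lip: "\<And>l. l \<in> L \<Longrightarrow> C-lipschitz_on (cball a r) (w l)"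
    and C_nonneg: "0 \<le> C" and r_pos: "0 < r" and closed_S: "closed S" and a_in: "a \<in> S"
    and max_nonneg: "\<And>x. x \<in> S \<Longrightarrow> \<exists>k\<in>K. 0 \<le> (\<Sum>l\<in>L. A k l * w l x)"
    and at_a: "\<And>k. k \<in> K \<Longrightarrow> (\<Sum>l\<in>L. A k l * w l a) \<le> 0"
begin

text \<open>The decoupled component; the original one is recovered on the diagonal
  \<open>y = (\<lambda>_. x)\<close>.\<close>

definition T :: "'k \<Rightarrow> ('l \<Rightarrow> 'a) \<Rightarrow> real" where
  "T k y = (\<Sum>l\<in>L. A k l * w l (y l))"

text \<open>
  The summand with factor \<open>1 / \<nu>\<close> makes the derivative with respect to every \<open>w l (y l)\<close> positive.
  It ensures that one can divide by it even if the softmax weight of \<open>w l\<close> vanishes.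
\<close>

definition penalized :: "real \<Rightarrow> 'a \<Rightarrow> ('l \<Rightarrow> 'a) \<Rightarrow> real" where
  "penalized \<nu> x y = lse \<nu> K (\<lambda>k. T k y) + (\<Sum>l\<in>L. w l (y l)) / \<nu>
     + ((\<Sum>l\<in>L. \<nu> * (norm (x - y l))\<^sup>2) + (norm (x - a))\<^sup>2)"

lemma penalized_minimizer_exists:
  "\<exists>x y. x \<in> S \<inter> cball a r \<and> (\<forall>l. y l \<in> cball a r) \<and>
    (\<forall>x' y'. x' \<in> S \<inter> cball a r \<longrightarrow> (\<forall>l. y' l \<in> cball a r) \<longrightarrow> penalized \<nu> x y \<le> penalized \<nu> x' y')"
proof -
  \<comment> \<open>All coordinates of \<open>y\<close> are confined to the ball, also those outside
    \<open>L\<close>, on which \<open>penalized\<close> does not depend; this makes \<open>X\<close>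
    compact.\<close>
  define X where "X = (S \<inter> cball a r) \<times> PiE (UNIV::'l set) (\<lambda>_. cball a r)"
  have X: "z \<in> X \<longleftrightarrow> fst z \<in> S \<inter> cball a r \<and> (\<forall>l. snd z l \<in> cball a r)" for z
    by (cases z) (auto simp: X_def PiE_iff)
  have "compact X" unfolding X_def
    using closed_S by (intro compact_Times compact_PiE_UNIV closed_Int_compact) auto
  moreover have "(a, \<lambda>_. a) \<in> X" using a_in r_pos by (simp add: X)
  then have "X \<noteq> {}" by blast
  moreover have "continuous_on X (\<lambda>z. penalized \<nu> (fst z) (snd z))"
  proof -
    have coord: "continuous_on X (\<lambda>z. snd z l)" for l
      by (rule continuous_on_product_then_coordinatewise[OF continuous_on_snd[OF continuous_on_id]])
    have comp: "continuous_on X (\<lambda>z. w l (snd z l))" if "l \<in> L" for l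
      by (rule continuous_on_compose2[OF lipschitz_on_continuous_on[OF lip[OF that]] coord]) (auto simp: X)
    show ?thesis
      unfolding penalized_def T_def divide_inverse
      by (intro continuous_on_add continuous_on_lse continuous_on_sum continuous_on_mult
          continuous_on_const continuous_on_power continuous_on_norm continuous_on_diff
          continuous_on_fst continuous_on_id comp coord finite_K K_nonempty)
  qed
  ultimately obtain z where z: "z \<in> X"
    and "\<And>z'. z' \<in> X \<Longrightarrow> penalized \<nu> (fst z) (snd z) \<le> penalized \<nu> (fst z') (snd z')"
    using continuous_attains_inf[of X "\<lambda>z. penalized \<nu> (fst z) (snd z)"] by meson
  then have "penalized \<nu> (fst z) (snd z) \<le> penalized \<nu> x' y'"
    if "x' \<in> S \<inter> cball a r" "\<forall>l. y' l \<in> cball a r" for x' y'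
    using that \<open>\<And>z'. z' \<in> X \<Longrightarrow> _\<close>[of "(x', y')"] by (simp add: X)
  then show ?thesis using z X by blast
qed



section \<open>Distance estimates and inactive weights at a minimizer\<close>

definition D :: real where
  "D = C * (\<Sum>k\<in>K. \<Sum>l\<in>L. A k l)"

text \<open>
  The three summands bound \<open>\<nu>\<close> times the smoothing error, \<open>\<nu>\<close> times the effect of the extra summand,
  and the loss in \<open>D * t \<le> \<nu> / 2 * t\<^sup>2 + D\<^sup>2 / (2 * \<nu>)\<close>.
\<close>

definition B :: real where
  "B = ln (card K) + card L * (C * r) + card L * (D\<^sup>2 / 2)"

lemma D_nonneg: "0 \<le> D"
  unfolding D_def using C_nonneg A_nonneg by (intro mult_nonneg_nonneg sum_nonneg) auto

lemma B_nonneg: "0 \<le> B"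
proof -
  have "1 \<le> card K" using finite_K K_nonempty by (simp add: Suc_le_eq card_gt_0_iff)
  then show ?thesis unfolding B_def using C_nonneg r_pos by (intro add_nonneg_nonneg) auto
qed

text \<open>All entries of \<open>A\<close> are nonnegative, so their total sum dominates each
  single entry and the one constant \<open>D\<close> serves every row.\<close>

lemma T_lipschitz:
  assumes "k \<in> K" "\<And>l. l \<in> L \<Longrightarrow> y l \<in> cball a r" "\<And>l. l \<in> L \<Longrightarrow> z l \<in> cball a r"
  shows "T k y - T k z \<le> D * (\<Sum>l\<in>L. norm (y l - z l))"
proof -
  have "A k l * w l (y l) - A k l * w l (z l) \<le> D * norm (y l - z l)" if l: "l \<in> L" for l
  proof -
    have "w l (y l) - w l (z l) \<le> C * norm (y l - z l)"
      using lipschitz_onD[OF lip[OF l] assms(2,3)[OF l]] by (simp add: dist_norm dist_real_def)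
    then have "A k l * (w l (y l) - w l (z l)) \<le> A k l * (C * norm (y l - z l))"
      using A_nonneg by (rule mult_left_mono)
    also have "\<dots> = A k l * C * norm (y l - z l)" by simp
    also have "\<dots> \<le> D * norm (y l - z l)"
    proof (rule mult_right_mono)
      have "A k l \<le> (\<Sum>l\<in>L. A k l)" using l finite_L A_nonneg by (intro member_le_sum) auto
      also have "\<dots> \<le> (\<Sum>k\<in>K. \<Sum>l\<in>L. A k l)"
        using assms(1) finite_K A_nonneg
        by (intro member_le_sum[of k K "\<lambda>k. \<Sum>l\<in>L. A k l"] sum_nonneg) auto
      finally show "A k l * C \<le> D"
        unfolding D_def using C_nonneg by (metis mult.commute mult_left_mono)
    qed simp
    finally show ?thesis by (simp add: right_diff_distrib)
  qed
  then show ?thesis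
    unfolding T_def sum_subtractf[symmetric] sum_distrib_left by (intro sum_mono) auto
qed

text \<open>On the diagonal at \<open>x\<close> some component is nonnegative by
  \<open>max_nonneg\<close>; moving from there to \<open>y\<close> costs no more than
  \<open>T_lipschitz\<close> allows.\<close>

lemma T_lower:
  assumes "x \<in> S \<inter> cball a r" "\<And>l. y l \<in> cball a r"
  shows "\<exists>k\<in>K. - D * (\<Sum>l\<in>L. norm (x - y l)) \<le> T k y"
proof -
  obtain k where "k \<in> K" "0 \<le> T k (\<lambda>_. x)"
    using max_nonneg[of x] assms by (auto simp: T_def)
  then show ?thesis
    using T_lipschitz[of k "\<lambda>_. x" y] assms by (intro bexI[of _ k]) auto
qed

text \<open>Compares the value at \<open>(x, y)\<close>, bounded below through
  \<open>T_lower\<close>, with the value at the diagonal point \<open>a\<close>, where the penalties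
  vanish. Half of the quadratic penalty absorbs the loss from decoupling; the other half stays on
  the left.\<close>

lemma penalized_minimizer_estimate:
  assumes "\<nu> > 0" and x: "x \<in> S \<inter> cball a r" and y: "\<And>l. y l \<in> cball a r"
    and le: "penalized \<nu> x y \<le> penalized \<nu> a (\<lambda>_. a)"
  shows "\<nu> / 2 * (\<Sum>l\<in>L. (norm (x - y l))\<^sup>2) + (norm (x - a))\<^sup>2 \<le> B / \<nu>"
proof -
  have "- D * (\<Sum>l\<in>L. norm (x - y l)) \<le> lse \<nu> K (\<lambda>k. T k y)"
    using T_lower[of x y, OF x y] lse_ge[OF finite_K _ \<open>\<nu> > 0\<close>] by (meson order_trans)
  moreover have "(\<Sum>l\<in>L. w l a) / \<nu> - (\<Sum>l\<in>L. w l (y l)) / \<nu> \<le> card L * (C * r) / \<nu>"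
  proof -
    have "w l a - w l (y l) \<le> C * r" if "l \<in> L" for l
    proof -
      have "w l a - w l (y l) \<le> C * dist a (y l)"
        using lipschitz_onD[OF lip[OF that], of a "y l"] y r_pos by (simp add: dist_real_def)
      also have "\<dots> \<le> C * r" using y[of l] C_nonneg by (intro mult_left_mono) auto
      finally show ?thesis .
    qed
    then have "(\<Sum>l\<in>L. w l a - w l (y l)) \<le> card L * (C * r)"
      by (rule sum_bounded_above)
    then show ?thesis
      using \<open>\<nu> > 0\<close> by (simp add: diff_divide_distrib[symmetric] sum_subtractf divide_right_mono)
  qed
  moreover have "lse \<nu> K (\<lambda>k. T k (\<lambda>_. a)) \<le> ln (card K) / \<nu>"
    using lse_le_of_nonpos[OF finite_K K_nonempty \<open>\<nu> > 0\<close>] at_a by (simp add: T_def)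
  moreover have "D * (\<Sum>l\<in>L. norm (x - y l)) \<le> \<nu> / 2 * (\<Sum>l\<in>L. (norm (x - y l))\<^sup>2) + card L * (D\<^sup>2 / 2) / \<nu>"
  proof -
    have "D * t \<le> \<nu> / 2 * t\<^sup>2 + D\<^sup>2 / 2 / \<nu>" for t
    proof -
      \<comment> \<open>Young's inequality by completing the square.\<close>
      have "0 \<le> (\<nu> * t - D)\<^sup>2 / (2 * \<nu>)" using \<open>\<nu> > 0\<close> by simp
      also have "\<dots> = \<nu> / 2 * t\<^sup>2 + D\<^sup>2 / 2 / \<nu> - D * t"
        using \<open>\<nu> > 0\<close> by (simp add: power2_eq_square field_simps)
      finally show ?thesis by simp
    qed
    then have "(\<Sum>l\<in>L. D * norm (x - y l)) \<le> (\<Sum>l\<in>L. \<nu> / 2 * (norm (x - y l))\<^sup>2 + D\<^sup>2 / 2 / \<nu>)"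
      by (intro sum_mono) auto
    then show ?thesis by (simp add: sum.distrib sum_distrib_left)
  qed
  moreover have "B / \<nu> = ln (card K) / \<nu> + card L * (C * r) / \<nu> + card L * (D\<^sup>2 / 2) / \<nu>"
    by (simp add: B_def add_divide_distrib)
  ultimately show ?thesis
    using le \<open>\<nu> > 0\<close> unfolding penalized_def sum_distrib_left[symmetric] by (simp add: algebra_simps)
qed

text \<open>Each summand on the left of the estimate is nonnegative and can be isolated. The rate
  \<open>1 / \<nu>\<close> for \<open>x - y l\<close> keeps \<open>\<nu> * norm (x - y l)\<close>
  bounded, which the exponents in \<open>softmax_inactive\<close> require.\<close>

lemma penalized_minimizer_near:
  assumes "\<nu> > 0" "x \<in> S \<inter> cball a r" "\<And>l. y l \<in> cball a r"
    and "penalized \<nu> x y \<le> penalized \<nu> a (\<lambda>_. a)"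
  shows "norm (x - a) \<le> sqrt (B / \<nu>)"
    and "l \<in> L \<Longrightarrow> norm (x - y l) \<le> sqrt (2 * B) / \<nu>"
proof -
  note est = penalized_minimizer_estimate[of \<nu> x y, OF assms]
  have "0 \<le> \<nu> / 2 * (\<Sum>l\<in>L. (norm (x - y l))\<^sup>2)"
    using assms(1) by (intro mult_nonneg_nonneg sum_nonneg) auto
  then have "(norm (x - a))\<^sup>2 \<le> B / \<nu>" using est by linarith
  then show "norm (x - a) \<le> sqrt (B / \<nu>)" by (rule real_le_rsqrt)
  assume "l \<in> L"
  then have "(norm (x - y l))\<^sup>2 \<le> (\<Sum>l\<in>L. (norm (x - y l))\<^sup>2)"
    using finite_L by (intro member_le_sum) auto
  then have "\<nu> / 2 * (norm (x - y l))\<^sup>2 \<le> \<nu> / 2 * (\<Sum>l\<in>L. (norm (x - y l))\<^sup>2)"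
    using assms(1) by (intro mult_left_mono) auto
  then have "\<nu> / 2 * (norm (x - y l))\<^sup>2 \<le> B / \<nu>" using est zero_le_power2[of "norm (x - a)"] by linarith
  then have "(\<nu> * norm (x - y l))\<^sup>2 \<le> 2 * B"
    using assms(1) by (simp add: power2_eq_square field_simps)
  then have "\<nu> * norm (x - y l) \<le> sqrt (2 * B)" by (rule real_le_rsqrt)
  then show "norm (x - y l) \<le> sqrt (2 * B) / \<nu>"
    using assms(1) by (simp add: field_simps)
qed

text \<open>Some \<open>k'\<close> has \<open>T k' y\<close> above a bound of order
  \<open>- 1 / \<nu>\<close>, while \<open>T k y\<close> stays below half of its value at
  \<open>a\<close>. After multiplication by \<open>\<nu>\<close> the gap enters
  \<open>softmax_le\<close>: the first bound contributes a constant, the second a multiple of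
  \<open>\<nu>\<close>.\<close>

lemma softmax_inactive:
  assumes "\<nu> > 0" "x \<in> S \<inter> cball a r" "\<And>l. y l \<in> cball a r"
    and "penalized \<nu> x y \<le> penalized \<nu> a (\<lambda>_. a)"
    and "k \<in> K" and small: "card L * D * (sqrt (B / \<nu>) + sqrt (2 * B) / \<nu>) \<le> - T k (\<lambda>_. a) / 2"
  shows "softmax \<nu> K (\<lambda>k. T k y) k \<le> exp (\<nu> * (T k (\<lambda>_. a) / 2) + card L * D * sqrt (2 * B))"
proof -
  note near = penalized_minimizer_near[of \<nu> x y, OF assms(1-4)]
  have "(\<Sum>l\<in>L. norm (x - y l)) \<le> card L * (sqrt (2 * B) / \<nu>)"
    using near(2) by (rule sum_bounded_above)
  then have "D * (\<Sum>l\<in>L. norm (x - y l)) \<le> D * (card L * (sqrt (2 * B) / \<nu>))"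
    using D_nonneg by (rule mult_left_mono)
  then obtain k' where k': "k' \<in> K" "- (card L * D * sqrt (2 * B) / \<nu>) \<le> T k' y"
    using T_lower[of x y, OF assms(2,3)] by (force simp: mult_ac)
  have "norm (y l - a) \<le> sqrt (B / \<nu>) + sqrt (2 * B) / \<nu>" if "l \<in> L" for l
    using near(1) near(2)[OF that] norm_triangle_ineq4[of "x - a" "x - y l"] by simp
  then have "(\<Sum>l\<in>L. norm (y l - a)) \<le> card L * (sqrt (B / \<nu>) + sqrt (2 * B) / \<nu>)"
    by (rule sum_bounded_above)
  then have "D * (\<Sum>l\<in>L. norm (y l - a)) \<le> D * (card L * (sqrt (B / \<nu>) + sqrt (2 * B) / \<nu>))"
    using D_nonneg by (rule mult_left_mono)
  moreover have "T k y - T k (\<lambda>_. a) \<le> D * (\<Sum>l\<in>L. norm (y l - a))"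
    using T_lipschitz[of k y "\<lambda>_. a"] assms r_pos by simp
  ultimately have "T k y \<le> T k (\<lambda>_. a) / 2"
    using small by (simp add: mult_ac)
  with k' have "\<nu> * T k y - \<nu> * T k' y
      \<le> \<nu> * (T k (\<lambda>_. a) / 2) - \<nu> * - (card L * D * sqrt (2 * B) / \<nu>)"
    using assms(1) by (intro diff_mono mult_left_mono) auto
  also have "\<dots> = \<nu> * (T k (\<lambda>_. a) / 2) + card L * D * sqrt (2 * B)"
    using assms(1) by simp
  finally show ?thesis
    using softmax_le[OF finite_K k'(1), of \<nu> "\<lambda>k. T k y" k] by (meson exp_le_cancel_iff order_trans)
qed

text \<open>Optimality in the single variable \<open>y l\<close>, with \<open>x\<close> and the
  other coordinates frozen. As \<open>y l\<close> lies in the open ball, all small perturbations of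
  it are admissible.\<close>

lemma penalized_minimizer_subgradient:
  fixes \<nu> :: real and y :: "'l \<Rightarrow> 'a" and l :: 'l
  defines "\<theta> \<equiv> (\<Sum>k\<in>K. softmax \<nu> K (\<lambda>k. T k y) k * A k l) + 1 / \<nu>"
  assumes "\<nu> > 0" and y: "\<And>l. y l \<in> cball a r" and "l \<in> L" and yl: "y l \<in> ball a r"
    and min: "\<And>y'. (\<And>l. y' l \<in> cball a r) \<Longrightarrow> penalized \<nu> x y \<le> penalized \<nu> x y'"
  shows "0 < \<theta>"
    and "0 < \<epsilon> \<Longrightarrow> \<forall>\<^sub>F u in nhds (y l).
      ((2 * \<nu> / \<theta>) *\<^sub>R (x - y l)) \<bullet> (u - y l) - \<epsilon> * norm (u - y l) \<le> w l u - w l (y l)"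
    and "norm ((2 * \<nu> / \<theta>) *\<^sub>R (x - y l)) \<le> C"
proof -
  have "0 \<le> (\<Sum>k\<in>K. softmax \<nu> K (\<lambda>k. T k y) k * A k l)"
    using A_nonneg softmax_nonneg by (intro sum_nonneg mult_nonneg_nonneg)
  then show \<theta>: "0 < \<theta>" using \<open>\<nu> > 0\<close> unfolding \<theta>_def by (simp add: add_nonneg_pos)
  \<comment> \<open>The first two summands of \<open>penalized\<close> as a function of the number
    \<open>s\<close> that replaces \<open>w l (y l)\<close>; its derivative there is
    \<open>\<theta>\<close>.\<close>
  define G where "G s = lse \<nu> K (\<lambda>k. T k y + A k l * (s - w l (y l)))
      + ((\<Sum>l\<in>L. w l (y l)) + (s - w l (y l))) / \<nu>" for s
  have "((\<lambda>s. lse \<nu> K (\<lambda>k. T k y + A k l * (s - w l (y l)))) has_real_derivative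
      (\<Sum>k\<in>K. softmax \<nu> K (\<lambda>k. T k y + A k l * (w l (y l) - w l (y l))) k * A k l)) (at (w l (y l)))"
    by (rule has_real_derivative_lse[OF finite_K K_nonempty \<open>\<nu> > 0\<close>])
      (auto intro!: derivative_eq_intros)
  then have deriv: "(G has_real_derivative \<theta>) (at (w l (y l)))"
    unfolding G_def \<theta>_def using \<open>\<nu> > 0\<close> by (auto intro!: derivative_eq_intros)
  have near: "\<forall>\<^sub>F u in nhds (y l). u \<in> ball a r"
    using yl by (intro eventually_nhds_in_open) auto
  then have lip_near: "\<forall>\<^sub>F u in nhds (y l). \<bar>w l u - w l (y l)\<bar> \<le> C * norm (u - y l)"
    by eventually_elim
      (use lipschitz_onD[OF lip[OF \<open>l \<in> L\<close>]] y in \<open>force simp: dist_norm dist_real_def\<close>)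
  have min_near: "\<forall>\<^sub>F u in nhds (y l). G (w l (y l)) + \<nu> * (norm (x - y l))\<^sup>2
      \<le> G (w l u) + \<nu> * (norm (x - u))\<^sup>2"
    using near
  proof eventually_elim
    case (elim u)
    have "penalized \<nu> x y \<le> penalized \<nu> x (y(l := u))"
      using min y elim by simp
    moreover have "T k (y(l := u)) = T k y + A k l * (w l u - w l (y l))" for k
      unfolding T_def using sum_fun_upd[OF finite_L \<open>l \<in> L\<close>, of "\<lambda>l z. A k l * w l z" y u]
      by (simp add: right_diff_distrib)
    ultimately show ?case
      unfolding penalized_def G_def
      using sum_fun_upd[OF finite_L \<open>l \<in> L\<close>, of w y u]
        sum_fun_upd[OF finite_L \<open>l \<in> L\<close>, of "\<lambda>l z. \<nu> * (norm (x - z))\<^sup>2" y u] by simp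
  qed
  note sub = subgradient_of_penalized_minimizer[OF lip_near deriv \<theta> min_near]
  show "0 < \<epsilon> \<Longrightarrow> \<forall>\<^sub>F u in nhds (y l).
      ((2 * \<nu> / \<theta>) *\<^sub>R (x - y l)) \<bullet> (u - y l) - \<epsilon> * norm (u - y l) \<le> w l u - w l (y l)"
    by (rule sub)
  \<comment> \<open>The subgradient inequality and the Lipschitz bound on \<open>w l\<close>
    together bound the linear form by \<open>(C + \<epsilon>) * norm (u - y l)\<close>.\<close>
  have "norm ((2 * \<nu> / \<theta>) *\<^sub>R (x - y l)) \<le> C + \<epsilon>" if "\<epsilon> > 0" for \<epsilon>
  proof -
    have "\<forall>\<^sub>F u in nhds (y l).
        ((2 * \<nu> / \<theta>) *\<^sub>R (x - y l)) \<bullet> (u - y l) \<le> (C + \<epsilon>) * norm (u - y l)"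
      using sub[OF that] lip_near by eventually_elim (simp add: distrib_right)
    from norm_le_of_eventually_inner_le[OF this] show ?thesis
      using C_nonneg that by simp
  qed
  then show "norm ((2 * \<nu> / \<theta>) *\<^sub>R (x - y l)) \<le> C"
    by (rule field_le_epsilon)
qed

section \<open>Approximate multipliers and their limits\<close>

lemma eventually_penalty_large:
  assumes "0 < \<delta>"
  shows "\<forall>\<^sub>F \<nu> in at_top. 0 < \<nu> \<and> sqrt (B / \<nu>) + sqrt (2 * B) / \<nu> < min \<delta> r \<and>
      2 * sqrt (B / \<nu>) + card L * C / \<nu> < \<delta> \<and>
      (\<forall>k\<in>K. T k (\<lambda>_. a) < 0 \<longrightarrow>
        card L * D * (sqrt (B / \<nu>) + sqrt (2 * B) / \<nu>) \<le> - T k (\<lambda>_. a) / 2 \<and>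
        exp (\<nu> * (T k (\<lambda>_. a) / 2) + card L * D * sqrt (2 * B)) < \<delta>)"
proof -
  have div: "((\<lambda>\<nu>. c / \<nu>) \<longlongrightarrow> 0) at_top" for c :: real
    by real_asymp
  have "((\<lambda>\<nu>. sqrt (B / \<nu>)) \<longlongrightarrow> 0) at_top"
    using tendsto_real_sqrt[OF div[of B]] by simp
  note tends = this div
  have 1: "((\<lambda>\<nu>. sqrt (B / \<nu>) + sqrt (2 * B) / \<nu>) \<longlongrightarrow> 0) at_top"
    using tendsto_add[OF tends] by simp
  have 2: "((\<lambda>\<nu>. 2 * sqrt (B / \<nu>) + card L * C / \<nu>) \<longlongrightarrow> 0) at_top"
    using tendsto_add[OF tendsto_mult_left[OF tends(1), of 2] tends(2)] by simp
  have 3: "((\<lambda>\<nu>. card L * D * (sqrt (B / \<nu>) + sqrt (2 * B) / \<nu>)) \<longlongrightarrow> 0) at_top"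
    using tendsto_mult_left[OF 1] by simp
  have 4: "((\<lambda>\<nu>. exp (\<nu> * (t / 2) + c)) \<longlongrightarrow> 0) at_top" if "t < 0" for t c :: real
    using that by real_asymp
  have "\<forall>\<^sub>F \<nu> in at_top. \<forall>k\<in>K. T k (\<lambda>_. a) < 0 \<longrightarrow>
        card L * D * (sqrt (B / \<nu>) + sqrt (2 * B) / \<nu>) \<le> - T k (\<lambda>_. a) / 2 \<and>
        exp (\<nu> * (T k (\<lambda>_. a) / 2) + card L * D * sqrt (2 * B)) < \<delta>"
  proof (rule eventually_ball_finite[OF finite_K], rule ballI)
    fix k
    show "\<forall>\<^sub>F \<nu> in at_top. T k (\<lambda>_. a) < 0 \<longrightarrow>
        card L * D * (sqrt (B / \<nu>) + sqrt (2 * B) / \<nu>) \<le> - T k (\<lambda>_. a) / 2 \<and>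
        exp (\<nu> * (T k (\<lambda>_. a) / 2) + card L * D * sqrt (2 * B)) < \<delta>"
    proof (cases "T k (\<lambda>_. a) < 0")
      case True
      then have "\<forall>\<^sub>F \<nu> in at_top.
          card L * D * (sqrt (B / \<nu>) + sqrt (2 * B) / \<nu>) < - T k (\<lambda>_. a) / 2"
        by (intro order_tendstoD(2)[OF 3]) simp
      with order_tendstoD(2)[OF 4[OF True] assms] show ?thesis
        by eventually_elim auto
    qed simp
  qed
  moreover have "\<forall>\<^sub>F \<nu> in at_top. sqrt (B / \<nu>) + sqrt (2 * B) / \<nu> < min \<delta> r"
    using assms r_pos by (intro order_tendstoD(2)[OF 1]) simp
  ultimately show ?thesis
    using order_tendstoD(2)[OF 2 assms] eventually_gt_at_top[of 0]
    by eventually_elim blast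
qed

text \<open>All objects come from one minimizer for a large \<open>\<nu>\<close>: \<open>p\<close>
  is the softmax vector, \<open>v l\<close> arises from optimality in \<open>y l\<close>, and
  \<open>N\<close> from optimality in \<open>x\<close>. The link is
  \<open>\<theta> l *\<^sub>R v l = (2 * \<nu>) *\<^sub>R (x - y l)\<close>.\<close>

lemma fuzzy_multipliers:
  assumes "0 < \<delta>"
  shows "\<exists>x y v p N. x \<in> S \<and> norm (x - a) < \<delta> \<and>
    (\<forall>l\<in>L. norm (y l - a) < \<delta> \<and> norm (v l) \<le> C \<and>
      (\<forall>\<epsilon>>0. (v l, -1) \<in> eps_normals \<epsilon> (y l, w l (y l)) (epi (\<lambda>z. ereal (w l z))))) \<and>
    (\<forall>k\<in>K. 0 \<le> p k \<and> (T k (\<lambda>_. a) < 0 \<longrightarrow> p k < \<delta>)) \<and> sum p K = 1 \<and>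
    (\<forall>\<epsilon>>0. N \<in> eps_normals \<epsilon> x S) \<and>
    norm (N + (\<Sum>l\<in>L. (\<Sum>k\<in>K. p k * A k l) *\<^sub>R v l)) < \<delta>"
proof -
  obtain \<nu> where "0 < \<nu>" and near: "sqrt (B / \<nu>) + sqrt (2 * B) / \<nu> < min \<delta> r"
    and err: "2 * sqrt (B / \<nu>) + card L * C / \<nu> < \<delta>"
    and inactive: "\<And>k. k \<in> K \<Longrightarrow> T k (\<lambda>_. a) < 0 \<Longrightarrow>
        card L * D * (sqrt (B / \<nu>) + sqrt (2 * B) / \<nu>) \<le> - T k (\<lambda>_. a) / 2 \<and>
        exp (\<nu> * (T k (\<lambda>_. a) / 2) + card L * D * sqrt (2 * B)) < \<delta>"
    using eventually_happens'[OF trivial_limit_at_top_linorder eventually_penalty_large[OF assms]]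
    by blast
  obtain x y where x: "x \<in> S \<inter> cball a r" and y: "\<And>l. y l \<in> cball a r"
    and min: "\<And>x' y'. x' \<in> S \<inter> cball a r \<Longrightarrow> (\<And>l. y' l \<in> cball a r) \<Longrightarrow>
      penalized \<nu> x y \<le> penalized \<nu> x' y'"
    using penalized_minimizer_exists[of \<nu>] by blast
  have le_a: "penalized \<nu> x y \<le> penalized \<nu> a (\<lambda>_. a)"
    using a_in r_pos by (intro min) auto
  note near_a = penalized_minimizer_near[OF \<open>0 < \<nu>\<close> x y le_a]
  \<comment> \<open>Being strictly below \<open>r\<close> puts \<open>x\<close>, and in the next
    step each \<open>y l\<close> with \<open>l \<in> L\<close>, inside the open ball, so the
    artificial ball constraint does not affect the optimality conditions.\<close>
  have xa: "norm (x - a) < min \<delta> r"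
    using near_a(1) near B_nonneg \<open>0 < \<nu>\<close> real_sqrt_ge_zero[of "2 * B"]
    by (smt (verit) divide_nonneg_pos)
  have ya: "norm (y l - a) < min \<delta> r" if "l \<in> L" for l
    using near_a(1) near_a(2)[OF that] norm_triangle_ineq4[of "x - a" "x - y l"] near by simp
  define p where "p = softmax \<nu> K (\<lambda>k. T k y)"
  define \<theta> where "\<theta> l = (\<Sum>k\<in>K. p k * A k l) + 1 / \<nu>" for l
  define v where "v l = (2 * \<nu> / \<theta> l) *\<^sub>R (x - y l)" for l
  define N where "N = - (\<Sum>l\<in>L. (2 * \<nu>) *\<^sub>R (x - y l)) - 2 *\<^sub>R (x - a)"
  have v: "0 < \<theta> l" "norm (v l) \<le> C"
    "0 < \<epsilon> \<Longrightarrow> (v l, -1) \<in> eps_normals \<epsilon> (y l, w l (y l)) (epi (\<lambda>z. ereal (w l z)))"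
    if "l \<in> L" for l \<epsilon>
  proof -
    have yl: "y l \<in> ball a r" using ya[OF that] by (simp add: dist_norm norm_minus_commute)
    have min_y: "penalized \<nu> x y \<le> penalized \<nu> x y'" if "\<And>l. y' l \<in> cball a r" for y'
      using min x that by blast
    show "0 < \<theta> l"
      unfolding \<theta>_def p_def
      by (rule penalized_minimizer_subgradient(1)[where \<nu> = \<nu> and x = x and y = y and l = l, OF \<open>0 < \<nu>\<close> y \<open>l \<in> L\<close> yl]) (rule min_y)
    show "norm (v l) \<le> C"
      unfolding v_def \<theta>_def p_def
      by (rule penalized_minimizer_subgradient(3)[where \<nu> = \<nu> and x = x and y = y and l = l, OF \<open>0 < \<nu>\<close> y \<open>l \<in> L\<close> yl]) (rule min_y)
    have sub: "\<forall>\<^sub>F u in nhds (y l). v l \<bullet> (u - y l) - \<epsilon> * norm (u - y l) \<le> w l u - w l (y l)"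
      if "0 < \<epsilon>"
      unfolding v_def \<theta>_def p_def
      by (rule penalized_minimizer_subgradient(2)[where \<nu> = \<nu> and x = x and y = y and l = l, OF \<open>0 < \<nu>\<close> y \<open>l \<in> L\<close> yl _ that]) (rule min_y)
    show "(v l, -1) \<in> eps_normals \<epsilon> (y l, w l (y l)) (epi (\<lambda>z. ereal (w l z)))" if "0 < \<epsilon>"
      using that sub[OF that] by (intro subgradient_imp_epi_normal) auto
  qed
  have N: "N \<in> eps_normals \<epsilon> x S" if "0 < \<epsilon>" for \<epsilon>
    unfolding N_def
  proof (rule local_minimizer_normal[OF _ that])
    have le: "penalized \<nu> x y \<le> penalized \<nu> u y" if "u \<in> S" "u \<in> ball a r" for u
      by (rule min[OF _ y]) (use that in auto)
    have "\<forall>\<^sub>F u in nhds x. u \<in> ball a r"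
      using xa by (intro eventually_nhds_in_open) (auto simp: dist_norm norm_minus_commute)
    then show "\<forall>\<^sub>F u in at x within S.
      (\<Sum>l\<in>L. \<nu> * (norm (x - y l))\<^sup>2) + (norm (x - a))\<^sup>2
        \<le> (\<Sum>l\<in>L. \<nu> * (norm (u - y l))\<^sup>2) + (norm (u - a))\<^sup>2"
      unfolding eventually_at_filter by eventually_elim (use le in \<open>simp add: penalized_def\<close>)
  qed
  \<comment> \<open>The residual has two sources: the gradient of
    \<open>(norm (x - a))\<^sup>2\<close> and the shift \<open>1 / \<nu>\<close> contained in
    \<open>\<theta> l\<close>. Both are small for large \<open>\<nu>\<close>.\<close>
  have "N + (\<Sum>l\<in>L. (\<Sum>k\<in>K. p k * A k l) *\<^sub>R v l) = - 2 *\<^sub>R (x - a) - (\<Sum>l\<in>L. (1 / \<nu>) *\<^sub>R v l)"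
  proof -
    have "(2 * \<nu>) *\<^sub>R (x - y l) = (\<Sum>k\<in>K. p k * A k l) *\<^sub>R v l + (1 / \<nu>) *\<^sub>R v l" if "l \<in> L" for l
    proof -
      have "(2 * \<nu>) *\<^sub>R (x - y l) = \<theta> l *\<^sub>R v l" using v(1)[OF that] by (simp add: v_def)
      then show ?thesis by (simp add: \<theta>_def scaleR_left_distrib)
    qed
    then have "(\<Sum>l\<in>L. (2 * \<nu>) *\<^sub>R (x - y l))
        = (\<Sum>l\<in>L. (\<Sum>k\<in>K. p k * A k l) *\<^sub>R v l) + (\<Sum>l\<in>L. (1 / \<nu>) *\<^sub>R v l)"
      by (simp add: sum.distrib[symmetric])
    then show ?thesis by (simp add: N_def)
  qed
  also have "norm \<dots> \<le> 2 * norm (x - a) + (\<Sum>l\<in>L. norm ((1 / \<nu>) *\<^sub>R v l))"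
    by (intro order_trans[OF norm_triangle_ineq4] add_mono norm_sum) simp
  also have "\<dots> \<le> 2 * sqrt (B / \<nu>) + card L * (C / \<nu>)"
    using near_a(1) v(2) \<open>0 < \<nu>\<close>
    by (intro add_mono mult_left_mono sum_bounded_above) (auto simp: divide_right_mono)
  also have "\<dots> < \<delta>" using err by simp
  finally have "norm (N + (\<Sum>l\<in>L. (\<Sum>k\<in>K. p k * A k l) *\<^sub>R v l)) < \<delta>" .
  moreover have "p k < \<delta>" if "k \<in> K" "T k (\<lambda>_. a) < 0" for k
    using softmax_inactive[OF \<open>0 < \<nu>\<close> x y le_a that(1)] inactive[OF that] unfolding p_def
    by linarith
  moreover have "sum p K = 1" "\<And>k. 0 \<le> p k"
    unfolding p_def by (simp_all add: sum_softmax finite_K K_nonempty softmax_nonneg)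
  ultimately show ?thesis using x xa ya v N
    by (intro exI[of _ x] exI[of _ y] exI[of _ v] exI[of _ p] exI[of _ N]) auto
qed

text \<open>Takes \<open>\<delta> = 1 / (n + 1)\<close> in \<open>fuzzy_multipliers\<close>. The
  weights lie in \<open>{0..1}\<close> and the subgradients in \<open>cball 0 C\<close>, so finitely
  many extractions give one subsequence along which all of them converge.\<close>

lemma limiting_multipliers:
  "\<exists>p v. (\<forall>k\<in>K. 0 \<le> p k \<and> p k * T k (\<lambda>_. a) = 0) \<and> sum p K = 1 \<and>
    (\<forall>l\<in>L. v l \<in> subdiff (\<lambda>z. ereal (w l z)) a) \<and>
    - (\<Sum>l\<in>L. (\<Sum>k\<in>K. p k * A k l) *\<^sub>R v l) \<in> normal_cone a S"
proof -
  define e where "e n = inverse (real (Suc n))" for n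
  have e_pos: "0 < e n" for n by (simp add: e_def)
  have e_lim: "e \<longlonglongrightarrow> 0" unfolding e_def by (rule LIMSEQ_inverse_real_of_nat)
  define P where "P n x y v p N \<longleftrightarrow> x \<in> S \<and> norm (x - a) < e n \<and>
    (\<forall>l\<in>L. norm (y l - a) < e n \<and> norm (v l) \<le> C \<and>
      (\<forall>\<epsilon>>0. (v l, -1) \<in> eps_normals \<epsilon> (y l, w l (y l)) (epi (\<lambda>z. ereal (w l z))))) \<and>
    (\<forall>k\<in>K. 0 \<le> p k \<and> (T k (\<lambda>_. a) < 0 \<longrightarrow> p k < e n)) \<and> sum p K = 1 \<and>
    (\<forall>\<epsilon>>0. N \<in> eps_normals \<epsilon> x S) \<and>
    norm (N + (\<Sum>l\<in>L. (\<Sum>k\<in>K. p k * A k l) *\<^sub>R v l)) < e n" for n x y v p N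
  have "\<exists>x y v p N. P n x y v p N" for n
    using fuzzy_multipliers[OF e_pos] unfolding P_def .
  then obtain x y v p N where P: "\<And>n. P n (x n) (y n) (v n) (p n) (N n)"
    by metis
  then have x: "\<And>n. x n \<in> S" "\<And>n. norm (x n - a) < e n"
    and y: "\<And>n l. l \<in> L \<Longrightarrow> norm (y n l - a) < e n" and v: "\<And>n l. l \<in> L \<Longrightarrow> norm (v n l) \<le> C"
    and epi: "\<And>n l \<epsilon>. l \<in> L \<Longrightarrow> 0 < \<epsilon> \<Longrightarrow>
      (v n l, -1) \<in> eps_normals \<epsilon> (y n l, w l (y n l)) (epi (\<lambda>z. ereal (w l z)))"
    and p: "\<And>n k. k \<in> K \<Longrightarrow> 0 \<le> p n k" "\<And>n. sum (p n) K = 1"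
    and inactive: "\<And>n k. k \<in> K \<Longrightarrow> T k (\<lambda>_. a) < 0 \<Longrightarrow> p n k < e n"
    and N: "\<And>n \<epsilon>. 0 < \<epsilon> \<Longrightarrow> N n \<in> eps_normals \<epsilon> (x n) S"
      "\<And>n. norm (N n + (\<Sum>l\<in>L. (\<Sum>k\<in>K. p n k * A k l) *\<^sub>R v n l)) < e n"
    unfolding P_def by simp_all
  have "p n k \<in> {0..1}" if "k \<in> K" for n k
    using p(1)[OF that] member_le_sum[of k K "p n"] p finite_K that by fastforce
  then obtain r1 q where r1: "strict_mono (r1 :: nat \<Rightarrow> nat)"
    and q1: "\<And>k. k \<in> K \<Longrightarrow> (\<lambda>n. p (r1 n) k) \<longlonglongrightarrow> q k"
    using compact_seqs_common_subseq[OF finite_K compact_Icc, of "\<lambda>k n. p n k" 0 1] by blast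
  have "v (r1 n) l \<in> cball 0 C" if "l \<in> L" for n l
    using v[OF that] by simp
  then obtain r2 u where r2: "strict_mono (r2 :: nat \<Rightarrow> nat)"
    and u2: "\<And>l. l \<in> L \<Longrightarrow> (\<lambda>n. v (r1 (r2 n)) l) \<longlonglongrightarrow> u l"
    using compact_seqs_common_subseq[OF finite_L compact_cball, of "\<lambda>l n. v (r1 n) l" 0 C] by blast
  define s where "s = r1 \<circ> r2"
  have s: "strict_mono s" unfolding s_def using r1 r2 by (rule strict_mono_o)
  have q: "(\<lambda>n. p (s n) k) \<longlonglongrightarrow> q k" if "k \<in> K" for k
    using LIMSEQ_subseq_LIMSEQ[OF q1[OF that] r2] by (simp add: s_def o_def)
  have u: "(\<lambda>n. v (s n) l) \<longlonglongrightarrow> u l" if "l \<in> L" for l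
    using u2[OF that] by (simp add: s_def)
  have e_s: "(\<lambda>n. e (s n)) \<longlonglongrightarrow> 0"
    using LIMSEQ_subseq_LIMSEQ[OF e_lim s] by (simp add: o_def)
  have lim_of_small: "f \<longlonglongrightarrow> b" if "\<And>n. norm (f n - b) < e (s n)"
    for f :: "nat \<Rightarrow> 'a" and b
    using Lim_null_comparison[OF _ e_s, of "\<lambda>n. f n - b"] that
    by (auto simp: LIM_zero_iff less_imp_le)
  have x_lim: "(\<lambda>n. x (s n)) \<longlonglongrightarrow> a"
    using x(2) by (rule lim_of_small)
  have y_lim: "(\<lambda>n. y (s n) l) \<longlonglongrightarrow> a" if "l \<in> L" for l
    using y[OF that] by (rule lim_of_small)
  have "(\<lambda>n. N (s n) + (\<Sum>l\<in>L. (\<Sum>k\<in>K. p (s n) k * A k l) *\<^sub>R v (s n) l)) \<longlonglongrightarrow> 0"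
    using N(2) by (intro lim_of_small) simp
  moreover have "(\<lambda>n. \<Sum>l\<in>L. (\<Sum>k\<in>K. p (s n) k * A k l) *\<^sub>R v (s n) l)
      \<longlonglongrightarrow> (\<Sum>l\<in>L. (\<Sum>k\<in>K. q k * A k l) *\<^sub>R u l)"
    using q u by (intro tendsto_sum tendsto_scaleR tendsto_mult tendsto_const) auto
  ultimately have N_lim: "(\<lambda>n. N (s n)) \<longlonglongrightarrow> - (\<Sum>l\<in>L. (\<Sum>k\<in>K. q k * A k l) *\<^sub>R u l)"
    using tendsto_diff by fastforce
  \<comment> \<open>\<open>N (s n)\<close> is an epsilon-normal for every positive epsilon, so the
    tolerances may be \<open>e n\<close> itself instead of \<open>e (s n)\<close>.\<close>
  have "- (\<Sum>l\<in>L. (\<Sum>k\<in>K. q k * A k l) *\<^sub>R u l) \<in> normal_cone a S"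
    by (rule normal_coneI[OF x_lim x(1) e_lim e_pos N_lim N(1)[OF e_pos]])
  moreover have "u l \<in> subdiff (\<lambda>z. ereal (w l z)) a" if l: "l \<in> L" for l
  proof -
    have "\<forall>\<^sub>F n in sequentially. y (s n) l \<in> ball a r"
      using y_lim[OF l] r_pos by (intro topological_tendstoD) auto
    then have "(\<lambda>n. w l (y (s n) l)) \<longlonglongrightarrow> w l a"
      using r_pos by (intro continuous_on_tendsto_compose[OF lipschitz_on_continuous_on[OF lip[OF l]] y_lim[OF l]])
        (auto elim: eventually_mono)
    then have X: "(\<lambda>n. (y (s n) l, w l (y (s n) l))) \<longlonglongrightarrow> (a, w l a)"
      using y_lim[OF l] by (rule tendsto_Pair[rotated])
    have Z: "(\<lambda>n. (v (s n) l, -1 :: real)) \<longlonglongrightarrow> (u l, -1)"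
      using u[OF l] by (rule tendsto_Pair) simp
    have "(u l, -1) \<in> normal_cone (a, w l a) (epi (\<lambda>z. ereal (w l z)))"
      by (rule normal_coneI[OF X _ e_lim e_pos Z epi[OF l e_pos]]) (simp add: epi_def)
    then show ?thesis by (simp add: subdiff_def)
  qed
  \<comment> \<open>Complementarity: by \<open>at_a\<close> the value at \<open>a\<close> is either
    0 or negative, and in the negative case the weights are below \<open>e (s n)\<close>.\<close>
  moreover have "0 \<le> q k \<and> q k * T k (\<lambda>_. a) = 0" if k: "k \<in> K" for k
  proof -
    have "0 \<le> q k"
      using q[OF k] p(1)[OF k] by (intro LIMSEQ_le_const) auto
    moreover have "q k \<le> 0" if "T k (\<lambda>_. a) < 0"
      using q[OF k] e_s inactive[OF k that] by (intro LIMSEQ_le) (auto intro: less_imp_le)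
    moreover have "T k (\<lambda>_. a) \<le> 0"
      using at_a[OF k] by (simp add: T_def)
    ultimately show ?thesis by force
  qed
  moreover have "sum q K = 1"
  proof (rule LIMSEQ_unique)
    show "(\<lambda>n. sum (p (s n)) K) \<longlonglongrightarrow> sum q K" using q by (intro tendsto_sum) auto
  qed (simp add: p)
  ultimately show ?thesis
    by (intro exI[of _ q] exI[of _ u] conjI ballI) blast+
qed

end

section \<open>Multiplier rules for locally Lipschitzian data\<close>

lemma lagrange_multipliers_max:
  fixes w :: "'l \<Rightarrow> 'a::euclidean_space \<Rightarrow> real"
  assumes "finite K" "K \<noteq> {}" "finite L" "\<And>k l. 0 \<le> A k l"
    and "\<And>l. l \<in> L \<Longrightarrow> locally_lipschitzian (w l)" and "closed S" "a \<in> S"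
    and "\<And>x. x \<in> S \<Longrightarrow> \<exists>k\<in>K. 0 \<le> (\<Sum>l\<in>L. A k l * w l x)"
    and "\<And>k. k \<in> K \<Longrightarrow> (\<Sum>l\<in>L. A k l * w l a) \<le> 0"
  obtains p v where "\<And>k. k \<in> K \<Longrightarrow> 0 \<le> p k" "sum p K = 1"
    "\<And>k. k \<in> K \<Longrightarrow> p k * (\<Sum>l\<in>L. A k l * w l a) = 0"
    "\<And>l. l \<in> L \<Longrightarrow> v l \<in> subdiff (\<lambda>z. ereal (w l z)) a"
    "- (\<Sum>l\<in>L. (\<Sum>k\<in>K. p k * A k l) *\<^sub>R v l) \<in> normal_cone a S"
proof -
  obtain r C where "r > 0" and C: "\<And>l. l \<in> L \<Longrightarrow> C-lipschitz_on (cball a r) (w l)"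
    using locally_lipschitzian_uniform[of L w a] assms(3,5) by blast
  \<comment> \<open>For empty \<open>L\<close> nothing forces \<open>C\<close> to be
    nonnegative.\<close>
  have "(max C 0)-lipschitz_on (cball a r) (w l)" if "l \<in> L" for l
    using C[OF that] by (rule lipschitz_on_le) simp
  then interpret max_multiplier K L A w S a r "max C 0"
    using assms \<open>r > 0\<close> by unfold_locales auto
  obtain p v where "\<forall>k\<in>K. 0 \<le> p k \<and> p k * T k (\<lambda>_. a) = 0" "sum p K = 1"
    "\<forall>l\<in>L. v l \<in> subdiff (\<lambda>z. ereal (w l z)) a"
    "- (\<Sum>l\<in>L. (\<Sum>k\<in>K. p k * A k l) *\<^sub>R v l) \<in> normal_cone a S"
    using limiting_multipliers by blast
  then show thesis
    unfolding T_def using that[of p v] by blast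
qed

text \<open>The case of two ingredients per component, later a numerator and a negative denominator.
  The ingredients are indexed by \<open>K \<times> UNIV\<close> with a Boolean tag, and row
  \<open>k\<close> of the matrix meets only the columns \<open>(k, True)\<close> and
  \<open>(k, False)\<close>.\<close>

lemma lagrange_multipliers_max_of_sums:
  fixes w1 w2 :: "'k \<Rightarrow> 'a::euclidean_space \<Rightarrow> real"
  assumes "finite K" "K \<noteq> {}" "\<And>k. k \<in> K \<Longrightarrow> 0 \<le> c1 k" "\<And>k. k \<in> K \<Longrightarrow> 0 \<le> c2 k"
    and lip: "\<And>k. k \<in> K \<Longrightarrow> locally_lipschitzian (w1 k)" "\<And>k. k \<in> K \<Longrightarrow> locally_lipschitzian (w2 k)"
    and "closed S" "a \<in> S"
    and "\<And>x. x \<in> S \<Longrightarrow> \<exists>k\<in>K. 0 \<le> c1 k * w1 k x + c2 k * w2 k x"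
    and "\<And>k. k \<in> K \<Longrightarrow> c1 k * w1 k a + c2 k * w2 k a \<le> 0"
  obtains p v1 v2 where "\<And>k. k \<in> K \<Longrightarrow> 0 \<le> p k" "sum p K = 1"
    "\<And>k. k \<in> K \<Longrightarrow> p k * (c1 k * w1 k a + c2 k * w2 k a) = 0"
    "\<And>k. k \<in> K \<Longrightarrow> v1 k \<in> subdiff (\<lambda>z. ereal (w1 k z)) a"
    "\<And>k. k \<in> K \<Longrightarrow> v2 k \<in> subdiff (\<lambda>z. ereal (w2 k z)) a"
    "- (\<Sum>k\<in>K. p k *\<^sub>R (c1 k *\<^sub>R v1 k + c2 k *\<^sub>R v2 k)) \<in> normal_cone a S"
proof -
  define w where "w = (\<lambda>(k, b). if b then w1 k else w2 k)"
  \<comment> \<open>The test \<open>k \<in> K\<close> makes \<open>A\<close> nonnegative everywhere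
    although \<open>c1\<close> and \<open>c2\<close> are nonnegative only on
    \<open>K\<close>.\<close>
  define A where "A k = (\<lambda>(k', b). if k' = k \<and> k \<in> K then if b then c1 k else c2 k else 0)" for k
  have sum_L: "(\<Sum>l\<in>K \<times> UNIV. f l) = (\<Sum>k\<in>K. f (k, True) + f (k, False))"
    for f :: "'k \<times> bool \<Rightarrow> 'b::comm_monoid_add"
    by (simp add: sum.cartesian_product' UNIV_bool add.commute)
  have sum_A: "(\<Sum>l\<in>K \<times> UNIV. A k l * w l x) = c1 k * w1 k x + c2 k * w2 k x" if "k \<in> K" for k x
  proof -
    have "(\<Sum>l\<in>K \<times> UNIV. A k l * w l x)
        = (\<Sum>k'\<in>K. if k' = k then c1 k * w1 k x + c2 k * w2 k x else 0)"
      unfolding sum_L using that by (intro sum.cong) (auto simp: A_def w_def)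
    then show ?thesis using that \<open>finite K\<close> by simp
  qed
  have "finite (K \<times> (UNIV :: bool set))" using \<open>finite K\<close> by simp
  moreover have "0 \<le> A k l" for k l
    using assms(3,4) by (simp add: A_def split: prod.split)
  moreover have "locally_lipschitzian (w l)" if "l \<in> K \<times> UNIV" for l
    using that lip by (auto simp: w_def)
  moreover have "\<exists>k\<in>K. 0 \<le> (\<Sum>l\<in>K \<times> UNIV. A k l * w l x)" if "x \<in> S" for x
    using assms(9)[OF that] sum_A by force
  moreover have "(\<Sum>l\<in>K \<times> UNIV. A k l * w l a) \<le> 0" if "k \<in> K" for k
    using assms(10)[OF that] sum_A[OF that] by simp
  ultimately show thesis
  proof (rule lagrange_multipliers_max[where w = w and A = A, OF assms(1,2) _ _ _ \<open>closed S\<close> \<open>a \<in> S\<close>])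
    fix p v
    assume p: "\<And>k. k \<in> K \<Longrightarrow> 0 \<le> p k" "sum p K = 1"
      "\<And>k. k \<in> K \<Longrightarrow> p k * (\<Sum>l\<in>K \<times> UNIV. A k l * w l a) = 0"
    and v: "\<And>l. l \<in> K \<times> UNIV \<Longrightarrow> v l \<in> subdiff (\<lambda>z. ereal (w l z)) a"
    and N: "- (\<Sum>l\<in>K \<times> UNIV. (\<Sum>k\<in>K. p k * A k l) *\<^sub>R v l) \<in> normal_cone a S"
    have "(\<Sum>k'\<in>K. p k' * A k' (k, b)) = p k * (if b then c1 k else c2 k)" if "k \<in> K" for k b
    proof -
      have "(\<Sum>k'\<in>K. p k' * A k' (k, b)) = (\<Sum>k'\<in>K. if k' = k then p k * (if b then c1 k else c2 k) else 0)"
        by (rule sum.cong) (auto simp: A_def)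
      then show ?thesis using that \<open>finite K\<close> by simp
    qed
    then have "(\<Sum>l\<in>K \<times> UNIV. (\<Sum>k\<in>K. p k * A k l) *\<^sub>R v l)
        = (\<Sum>k\<in>K. p k *\<^sub>R (c1 k *\<^sub>R v (k, True) + c2 k *\<^sub>R v (k, False)))"
      unfolding sum_L by (intro sum.cong) (auto simp: scaleR_right_distrib)
    then show thesis
      using that[of p "\<lambda>k. v (k, True)" "\<lambda>k. v (k, False)"] p N v[of "(_, True)"] v[of "(_, False)"]
      by (simp add: sum_A) (simp add: w_def)
  qed
qed

section \<open>The fractional problem\<close>

lemma sum_mem_set_sum:
  assumes "\<And>i. i \<in> I \<Longrightarrow> f i \<in> F i"
  shows "sum f I \<in> sum F I"
  using assms by (induction I rule: infinite_finite_induct) auto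

text \<open>Two signs cancel: \<open>- u\<close> is an upper subgradient of \<open>\<psi>\<close>,
  and \<open>frac_term\<close> scales it by a negated quotient.\<close>

lemma frac_term_memI:
  assumes "v \<in> subdiff (\<lambda>y. ereal (\<phi> y)) x" "u \<in> subdiff (\<lambda>y. ereal (- \<psi> y)) x"
  shows "v + (\<phi> x / \<psi> x) *\<^sub>R u \<in> frac_term \<phi> \<psi> x"
proof -
  have "- u \<in> upper_subdiff (\<lambda>y. ereal (\<psi> y)) x"
    using assms(2) unfolding upper_subdiff_def by simp
  then have "(- (\<phi> x / \<psi> x)) *\<^sub>R (- u) \<in> (*\<^sub>R) (- (\<phi> x / \<psi> x)) ` upper_subdiff (\<lambda>y. ereal (\<psi> y)) x"
    by (rule imageI)
  with assms(1) show ?thesis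
    unfolding frac_term_def by (simp add: set_plus_intro)
qed

text \<open>Clears the denominator \<open>g\<close>. The extra division by \<open>g0\<close>
  produces the coefficients that stand in the KKT condition.\<close>

lemma frac_ge_imp_linear_ge:
  fixes f g f0 g0 :: real
  assumes "0 < g" "0 < g0" "\<not> f / g < f0 / g0"
  shows "0 \<le> 1 / g0 * f + f0 / g0 / g0 * - g"
proof -
  have "f0 / g0 * g \<le> f" using assms by (simp add: not_less pos_le_divide_eq)
  then have "0 \<le> (f - f0 / g0 * g) / g0" using assms by simp
  then show ?thesis by (simp add: diff_divide_distrib)
qed

theorem theorem3p2:
  fixes S :: "(real ^ 'n) set"
    and m p :: nat
    and fL fU gL gU h :: "nat \<Rightarrow> real ^ 'n \<Rightarrow> real"
    and xb :: "real ^ 'n"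
  assumes "S \<noteq> {}" and "closed S"
    and "\<And>i. i \<in> {1..m} \<Longrightarrow> locally_lipschitzian (fL i)"
    and "\<And>i. i \<in> {1..m} \<Longrightarrow> locally_lipschitzian (fU i)"
    and "\<And>i. i \<in> {1..m} \<Longrightarrow> locally_lipschitzian (gL i)"
    and "\<And>i. i \<in> {1..m} \<Longrightarrow> locally_lipschitzian (gU i)"
    and "\<And>j. j \<in> {1..p} \<Longrightarrow> locally_lipschitzian (h j)"
    and "\<And>x i. x \<in> S \<Longrightarrow> i \<in> {1..m} \<Longrightarrow> 0 \<le> fL i x \<and> fL i x \<le> fU i x"
    and "\<And>x i. x \<in> S \<Longrightarrow> i \<in> {1..m} \<Longrightarrow> 0 < gL i x \<and> gL i x \<le> gU i x"
    and "xb \<in> feasible_set S p h"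
    and "type2_weakly_pareto m (frac_ivl fL fU gL gU) (feasible_set S p h) xb"
    and "CQ S p h xb"
  shows "KKT S m p fL fU gL gU h xb"
proof -
  \<comment> \<open>The three blocks are the lower end points, the upper end points and the
    constraints. For a constraint the second ingredient is filled with \<open>h\<close> itself,
    which is locally Lipschitzian, at weight 0.\<close>
  define K where "K = {1..m} <+> ({1..m} <+> {1..p})"
  define w1 where "w1 = case_sum fL (case_sum fU h)"
  define w2 where "w2 = case_sum (\<lambda>i y. - gU i y) (case_sum (\<lambda>i y. - gL i y) h)"
  define c1 where "c1 = case_sum (\<lambda>i. 1 / gU i xb) (case_sum (\<lambda>i. 1 / gL i xb) (\<lambda>j::nat. 1))"
  define c2 where "c2 = case_sum (\<lambda>i. fL i xb / gU i xb / gU i xb)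
    (case_sum (\<lambda>i. fU i xb / gL i xb / gL i xb) (\<lambda>j::nat. 0))"
  note defs = K_def w1_def w2_def c1_def c2_def
  have xb: "xb \<in> S" "\<And>j. j \<in> {1..p} \<Longrightarrow> h j xb \<le> 0"
    using assms(10) by (auto simp: feasible_set_def)
  have f: "0 \<le> fL i x" "0 \<le> fU i x" "fL i x \<le> fU i x"
    and g: "0 < gL i x" "0 < gU i x" "gL i x \<le> gU i x" if "x \<in> S" "i \<in> {1..m}" for x i
    using assms(8,9)[OF that] by linarith+
  have LU: "less_LU_strict (frac_ivl fL fU gL gU i x) (frac_ivl fL fU gL gU i xb) \<longleftrightarrow>
      fL i x / gU i x < fL i xb / gU i xb \<and> fU i x / gL i x < fU i xb / gL i xb"
    if "x \<in> S" "i \<in> {1..m}" for x i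
  proof -
    have "fL i z / gU i z \<le> fU i z / gL i z" if "z \<in> S" for z
      using f[OF that \<open>i \<in> _\<close>] g[OF that \<open>i \<in> _\<close>] by (intro frac_le) auto
    then show ?thesis
      using that xb by (simp add: less_LU_strict_def frac_ivl_def lower.rep_eq upper.rep_eq Ivl.rep_eq)
  qed
  have "finite K" by (simp add: K_def)
  \<comment> \<open>For \<open>m = 0\<close> the domination condition would hold vacuously, so
    \<open>xb\<close> would dominate itself; weak Pareto optimality therefore forces
    \<open>m \<ge> 1\<close>.\<close>
  moreover have "K \<noteq> {}"
    using assms(11) unfolding type2_weakly_pareto_def K_def by auto
  moreover have "0 \<le> c1 k" "0 \<le> c2 k" if "k \<in> K" for k
    using that f[OF xb(1)] g[OF xb(1)] by (auto simp: defs less_imp_le)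
  moreover have "locally_lipschitzian (w1 k)" "locally_lipschitzian (w2 k)" if "k \<in> K" for k
    using that assms(3-7) by (auto simp: defs intro!: locally_lipschitzian_uminus)
  \<comment> \<open>At a feasible point weak Pareto optimality provides an end point that does not
    strictly decrease; at an infeasible point of \<open>S\<close> a violated constraint is
    positive.\<close>
  moreover have "\<exists>k\<in>K. 0 \<le> c1 k * w1 k x + c2 k * w2 k x" if x: "x \<in> S" for x
  proof (cases "x \<in> feasible_set S p h")
    case True
    then obtain i where i: "i \<in> {1..m}"
      "\<not> (fL i x / gU i x < fL i xb / gU i xb \<and> fU i x / gL i x < fU i xb / gL i xb)"
      using assms(11) LU[OF x] unfolding type2_weakly_pareto_def by blast
    then consider "\<not> fL i x / gU i x < fL i xb / gU i xb" | "\<not> fU i x / gL i x < fU i xb / gL i xb"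
      by blast
    then show ?thesis
    proof cases
      case 1
      from frac_ge_imp_linear_ge[OF _ _ 1] g[OF x i(1)] g[OF xb(1) i(1)] i(1) show ?thesis
        by (intro bexI[of _ "Inl i"]) (auto simp: defs)
    next
      case 2
      from frac_ge_imp_linear_ge[OF _ _ 2] g[OF x i(1)] g[OF xb(1) i(1)] i(1) show ?thesis
        by (intro bexI[of _ "Inr (Inl i)"]) (auto simp: defs)
    qed
  next
    case False
    then obtain j where "j \<in> {1..p}" "0 < h j x"
      using x by (auto simp: feasible_set_def)
    then show ?thesis
      by (intro bexI[of _ "Inr (Inr j)"]) (auto simp: defs)
  qed
  \<comment> \<open>At \<open>xb\<close> the components of the quotients vanish, so complementarity
    restricts only the weights of the constraints.\<close>
  moreover have "c1 k * w1 k xb + c2 k * w2 k xb \<le> 0" if "k \<in> K" for k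
    using that xb(2) g[OF xb(1)] by (force simp: defs)
  ultimately show ?thesis
  proof (rule lagrange_multipliers_max_of_sums[where ?c1.0 = c1 and ?c2.0 = c2 and ?w1.0 = w1
        and ?w2.0 = w2, OF _ _ _ _ _ _ \<open>closed S\<close> xb(1)])
    fix q v1 v2
    assume q: "\<And>k. k \<in> K \<Longrightarrow> 0 \<le> q k" "sum q K = 1"
      "\<And>k. k \<in> K \<Longrightarrow> q k * (c1 k * w1 k xb + c2 k * w2 k xb) = 0"
      and v: "\<And>k. k \<in> K \<Longrightarrow> v1 k \<in> subdiff (\<lambda>z. ereal (w1 k z)) xb"
        "\<And>k. k \<in> K \<Longrightarrow> v2 k \<in> subdiff (\<lambda>z. ereal (w2 k z)) xb"
      and N: "- (\<Sum>k\<in>K. q k *\<^sub>R (c1 k *\<^sub>R v1 k + c2 k *\<^sub>R v2 k)) \<in> normal_cone xb S"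
    define lamL where "lamL i = q (Inl i)" for i
    define lamU where "lamU i = q (Inr (Inl i))" for i
    define \<mu> where "\<mu> j = q (Inr (Inr j))" for j
    have sum_K: "sum \<phi> K = (\<Sum>i\<in>{1..m}. \<phi> (Inl i)) + ((\<Sum>i\<in>{1..m}. \<phi> (Inr (Inl i))) + (\<Sum>j\<in>{1..p}. \<phi> (Inr (Inr j))))"
      for \<phi> :: "nat + nat + nat \<Rightarrow> 'b::comm_monoid_add"
      unfolding K_def by (simp add: sum.Plus)
    have K_iff: "Inl i \<in> K \<longleftrightarrow> i \<in> {1..m}" "Inr (Inl i) \<in> K \<longleftrightarrow> i \<in> {1..m}"
      "Inr (Inr j) \<in> K \<longleftrightarrow> j \<in> {1..p}" for i j
      by (auto simp: K_def)
    have mu_h: "\<mu> j * h j xb = 0" if "j \<in> {1..p}" for j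
      using q(3)[of "Inr (Inr j)"] that by (simp add: K_iff w1_def w2_def c1_def c2_def \<mu>_def)
    have nonneg: "\<And>i. i \<in> {1..m} \<Longrightarrow> 0 \<le> lamL i" "\<And>i. i \<in> {1..m} \<Longrightarrow> 0 \<le> lamU i"
      "\<And>j. j \<in> {1..p} \<Longrightarrow> 0 \<le> \<mu> j"
      using q(1) by (simp_all add: K_iff lamL_def lamU_def \<mu>_def)
    have sum_1: "(\<Sum>i\<in>{1..m}. lamL i + lamU i) + (\<Sum>j\<in>{1..p}. \<mu> j) = 1"
      using q(2) unfolding sum_K lamL_def lamU_def \<mu>_def by (simp add: sum.distrib)
    define tL where "tL i = (lamL i / gU i xb) *\<^sub>R (v1 (Inl i) + (fL i xb / gU i xb) *\<^sub>R v2 (Inl i))" for i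
    define tU where "tU i = (lamU i / gL i xb) *\<^sub>R
      (v1 (Inr (Inl i)) + (fU i xb / gL i xb) *\<^sub>R v2 (Inr (Inl i)))" for i
    define tH where "tH j = \<mu> j *\<^sub>R v1 (Inr (Inr j))" for j
    have tL: "tL i \<in> (*\<^sub>R) (lamL i / gU i xb) ` frac_term (fL i) (gU i) xb" if "i \<in> {1..m}" for i
      unfolding tL_def using v[of "Inl i"] that
      by (intro imageI frac_term_memI) (auto simp: K_iff w1_def w2_def)
    have tU: "tU i \<in> (*\<^sub>R) (lamU i / gL i xb) ` frac_term (fU i) (gL i) xb" if "i \<in> {1..m}" for i
      unfolding tU_def using v[of "Inr (Inl i)"] that
      by (intro imageI frac_term_memI) (auto simp: K_iff w1_def w2_def)
    have tH: "tH j \<in> (*\<^sub>R) (\<mu> j) ` subdiff (\<lambda>y. ereal (h j y)) xb" if "j \<in> {1..p}" for j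
      unfolding tH_def using v(1)[of "Inr (Inr j)"] that
      by (intro imageI) (auto simp: K_iff w1_def)
    define n where "n = - (sum tL {1..m} + sum tU {1..m} + sum tH {1..p})"
    have "(\<Sum>k\<in>K. q k *\<^sub>R (c1 k *\<^sub>R v1 k + c2 k *\<^sub>R v2 k))
        = sum tL {1..m} + sum tU {1..m} + sum tH {1..p}"
      unfolding sum_K tL_def tU_def tH_def lamL_def lamU_def \<mu>_def
      by (simp add: c1_def c2_def scaleR_right_distrib add.assoc mult.commute)
    with N have n: "n \<in> normal_cone xb S" by (simp add: n_def)
    \<comment> \<open>If all objective multipliers vanished, the \<open>\<mu> j\<close> would sum to
      1, be supported on the active constraints by complementarity, and satisfy exactly the
      inclusion that (CQ) excludes.\<close>
    have nz: "\<exists>i\<in>{1..m}. lamL i \<noteq> 0 \<or> lamU i \<noteq> 0"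
    proof (rule ccontr)
      assume "\<not> (\<exists>i\<in>{1..m}. lamL i \<noteq> 0 \<or> lamU i \<noteq> 0)"
      then have zero: "\<And>i. i \<in> {1..m} \<Longrightarrow> lamL i = 0" "\<And>i. i \<in> {1..m} \<Longrightarrow> lamU i = 0"
        by auto
      let ?J = "active_set p h xb"
      have J: "?J \<subseteq> {1..p}" "\<And>j. j \<in> {1..p} - ?J \<Longrightarrow> \<mu> j = 0"
        using mu_h by (auto simp: active_set_def)
      have "sum \<mu> ?J = sum \<mu> {1..p}" "sum tH ?J = sum tH {1..p}"
        using J by (auto intro!: sum.mono_neutral_left simp: tH_def)
      moreover have "sum \<mu> {1..p} = 1" using sum_1 zero by simp
      moreover have "sum tH {1..p} + n = 0" using zero by (simp add: n_def tL_def tU_def)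
      ultimately have "sum \<mu> ?J \<noteq> 0" "sum tH ?J + n = 0" by simp_all
      moreover have "sum tH ?J \<in> (\<Sum>j\<in>?J. (*\<^sub>R) (\<mu> j) ` subdiff (\<lambda>y. ereal (h j y)) xb)"
        using J(1) by (intro sum_mem_set_sum tH) blast
      note set_plus_intro[OF this n]
      ultimately have "0 \<in> (\<Sum>j\<in>?J. (*\<^sub>R) (\<mu> j) ` subdiff (\<lambda>y. ereal (h j y)) xb) + normal_cone xb S"
        by simp
      moreover have "\<exists>j\<in>?J. \<mu> j \<noteq> 0" using \<open>sum \<mu> ?J \<noteq> 0\<close> sum.neutral by metis
      moreover have "\<forall>j\<in>?J. 0 \<le> \<mu> j" using J nonneg(3) by blast
      ultimately show False using assms(12) unfolding CQ_def by blast
    qed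
    have "sum tL {1..m} + sum tU {1..m} + sum tH {1..p} + n
      \<in> (\<Sum>i\<in>{1..m}. (*\<^sub>R) (lamL i / gU i xb) ` frac_term (fL i) (gU i) xb)
        + (\<Sum>i\<in>{1..m}. (*\<^sub>R) (lamU i / gL i xb) ` frac_term (fU i) (gL i) xb)
        + (\<Sum>j\<in>{1..p}. (*\<^sub>R) (\<mu> j) ` subdiff (\<lambda>y. ereal (h j y)) xb)
        + normal_cone xb S"
      by (intro set_plus_intro sum_mem_set_sum tL tU tH n)
    moreover have "sum tL {1..m} + sum tU {1..m} + sum tH {1..p} + n = 0"
      by (simp add: n_def)
    ultimately have stationary: "0 \<in> (\<Sum>i\<in>{1..m}. (*\<^sub>R) (lamL i / gU i xb) ` frac_term (fL i) (gU i) xb)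
        + (\<Sum>i\<in>{1..m}. (*\<^sub>R) (lamU i / gL i xb) ` frac_term (fU i) (gL i) xb)
        + (\<Sum>j\<in>{1..p}. (*\<^sub>R) (\<mu> j) ` subdiff (\<lambda>y. ereal (h j y)) xb)
        + normal_cone xb S"
      by (simp only:)
    show ?thesis
      unfolding KKT_def
      by (rule conjI[OF assms(10)], rule exI[of _ lamL], rule exI[of _ lamU], rule exI[of _ \<mu>])
        (intro conjI ballI nonneg sum_1 nz stationary mu_h)
  qed
qed

end
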